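(* Let $\omega\in\mathcal W_{\mathrm{Dou}}$ be a Douglas weight such that $\mathcal D(\omega)\subset H^2$. Then the reproducing kernel $k^\omega$ of $\mathcal D(\omega)$ satisfies $$2\,\mathrm{Re}\,k^\omega(z,w)-1\ge 0,\qquad z,w\in\mathbb D.$$
   Context: $\mathbb D$ is the open unit disk, $\mathbb T$ the unit circle, $dA$ the normalized area measure on $\mathbb D$, $L^2(\mathbb T)$ is taken with respect to normalized Lebesgue measure. A weight is a measurable function $\omega:\mathbb D\to[0,\infty)$ with $\int_{\mathbb D}\omega\,dA<\infty$. For $f\in L^2(\mathbb T)$, $P[f]$ is its Poisson extension to $\mathbb D$. The gradient is normalized by $\nabla u=(\partial u,\bar\partial u)$, so $|\nabla u|^2=|\partial u|^2+|\bar\partial u|^2$. A weight $\omega$ belongs to $\mathcal W_{\mathrm{Dou}}$ if there is a positive Borel measure $\mathbf J_\omega$ on $\mathbb T^2\setminus\mathrm{diag}$ with $\int_{\mathbb D}|\nabla P[f]|^2\omega\,dA=\int_{\mathbb T}\int_{\mathbb T}|f(\zeta)-f(\lambda)|^2\,\mathbf J_\omega(d\zeta,d\lambda)$ for every $f\in L^2(\mathbb T)$. $\mathcal D(\omega)$ is the space of holomorphic $f$ on $\mathbb D$ with $\mathcal D_\omega(f)=\int_{\mathbb D}|f'|^2\omega\,dA<\infty$. When $\mathcal D(\omega)\subset H^2$ (the Hardy space), $\mathcal D(\omega)$ with norm $\|f\|_\omega^2=\|f\|_{H^2}^2+\mathcal D_\omega(f)$ is a reproducing kernel Hilbert space on $\mathbb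 D$ with kernel $k^\omega$, i.e. $f(z)=\langle f,k^\omega(\cdot,z)\rangle_\omega$ for $f\in\mathcal D(\omega)$. *)

theory Defs
  imports "HOL-Analysis.Analysis"
begin

abbreviation unit_disk :: "complex set" (\<open>\<D>\<close>)
  where "\<D> \<equiv> ball 0 1"

abbreviation unit_circle :: "complex set" (\<open>\<T>\<close>)
  where "\<T> \<equiv> sphere 0 1"

definition disk_measure :: "complex measure"
  where "disk_measure = scale_measure (ennreal (1 / pi)) (lebesgue_on \<D>)"

definition circle_measure :: "complex measure"
  where "circle_measure =
    distr (uniform_measure lborel {0..2 * pi}) (restrict_space borel \<T>) cis"

definition weight :: "(complex \<Rightarrow> real) \<Rightarrow> bool"
  where "weight \<omega> \<longleftrightarrow>
    \<omega> \<in> borel_measurable disk_measure \<and>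
    (\<forall>z\<in>\<D>. 0 \<le> \<omega> z) \<and>
    (\<integral>\<^sup>+ z. ennreal (\<omega> z) \<partial>disk_measure) < \<infinity>"

text \<open>Elements of \<open>L\<^sup>2(\<T>)\<close> are represented by Borel functions on the circle, not by
  equivalence classes.\<close>

definition L2_circle :: "(complex \<Rightarrow> complex) set"
  where "L2_circle =
    {f \<in> borel_measurable circle_measure.
      integrable circle_measure (\<lambda>\<zeta>. (cmod (f \<zeta>))\<^sup>2)}"

definition poisson_extension :: "(complex \<Rightarrow> complex) \<Rightarrow> complex \<Rightarrow> complex"
  where "poisson_extension f z =
    (LINT \<zeta>|circle_measure. ((1 - (cmod z)\<^sup>2) / (cmod (\<zeta> - z))\<^sup>2) *\<^sub>R f \<zeta>)"

text \<open>The Wirtinger derivatives \<open>\<partial>u = (u\<^sub>x - \<i> u\<^sub>y) / 2\<close> and its conjugate counterpart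
  \<open>(u\<^sub>x + \<i> u\<^sub>y) / 2\<close>.\<close>

definition wirtinger_d :: "(complex \<Rightarrow> complex) \<Rightarrow> complex \<Rightarrow> complex"
  where "wirtinger_d u z =
    (frechet_derivative u (at z) 1 - \<i> * frechet_derivative u (at z) \<i>) / 2"

definition wirtinger_dbar :: "(complex \<Rightarrow> complex) \<Rightarrow> complex \<Rightarrow> complex"
  where "wirtinger_dbar u z =
    (frechet_derivative u (at z) 1 + \<i> * frechet_derivative u (at z) \<i>) / 2"

definition grad_norm_sq :: "(complex \<Rightarrow> complex) \<Rightarrow> complex \<Rightarrow> real"
  where "grad_norm_sq u z = (cmod (wirtinger_d u z))\<^sup>2 + (cmod (wirtinger_dbar u z))\<^sup>2"

text \<open>Both sides of the Douglas formula are integrals in \<open>[0, \<infinity>]\<close>. The formula is required for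
  every Borel representative \<open>f\<close>; applied to functions vanishing almost everywhere it says that
  the right-hand side does not depend on the representative.\<close>

definition douglas_weight :: "(complex \<Rightarrow> real) \<Rightarrow> bool"
  where "douglas_weight \<omega> \<longleftrightarrow>
    weight \<omega> \<and>
    (\<exists>J :: (complex \<times> complex) measure.
      sets J = sets (restrict_space borel {(\<zeta>, \<xi>). \<zeta> \<in> \<T> \<and> \<xi> \<in> \<T> \<and> \<zeta> \<noteq> \<xi>}) \<and>
      (\<forall>f\<in>L2_circle.
        (\<integral>\<^sup>+ z. ennreal (grad_norm_sq (poisson_extension f) z * \<omega> z) \<partial>disk_measure) =
        (\<integral>\<^sup>+ (\<zeta>, \<xi>). ennreal ((cmod (f \<zeta> - f \<xi>))\<^sup>2) \<partial>J)))"

definition dirichlet_space :: "(complex \<Rightarrow> real) \<Rightarrow> (complex \<Rightarrow> complex) set"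
  where "dirichlet_space \<omega> =
    {f. f holomorphic_on \<D> \<and>
      (\<integral>\<^sup>+ z. ennreal ((cmod (deriv f z))\<^sup>2 * \<omega> z) \<partial>disk_measure) < \<infinity>}"

definition hardy_space :: "(complex \<Rightarrow> complex) set"
  where "hardy_space =
    {f. f holomorphic_on \<D> \<and>
      bdd_above ((\<lambda>r. LINT \<zeta>|circle_measure. (cmod (f (complex_of_real r * \<zeta>)))\<^sup>2) ` {0..<1})}"

text \<open>On the diagonal the integral means increase with \<open>r\<close>, so the limit is their supremum, the
  squared Hardy norm.\<close>

definition hardy_inner :: "(complex \<Rightarrow> complex) \<Rightarrow> (complex \<Rightarrow> complex) \<Rightarrow> complex"
  where "hardy_inner f g =
    Lim (at_left (1::real))
      (\<lambda>r. LINT \<zeta>|circle_measure. f (complex_of_real r * \<zeta>) * cnj (g (complex_of_real r * \<zeta>)))"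

text \<open>The inner product that polarizes \<open>\<parallel>f\<parallel>\<^sub>\<omega>\<^sup>2 = \<parallel>f\<parallel>\<^sup>2 + \<integral> |f'|\<^sup>2 \<omega> dA\<close>, with the Hardy norm on the right; linear in
  the first argument.\<close>

definition dirichlet_inner ::
  "(complex \<Rightarrow> real) \<Rightarrow> (complex \<Rightarrow> complex) \<Rightarrow> (complex \<Rightarrow> complex) \<Rightarrow> complex"
  where "dirichlet_inner \<omega> f g =
    hardy_inner f g + (LINT z|disk_measure. deriv f z * cnj (deriv g z) * complex_of_real (\<omega> z))"

definition reproducing_kernel ::
  "(complex \<Rightarrow> real) \<Rightarrow> (complex \<Rightarrow> complex \<Rightarrow> complex) \<Rightarrow> bool"
  where "reproducing_kernel \<omega> k \<longleftrightarrow>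
    (\<forall>w\<in>\<D>. (\<lambda>z. k z w) \<in> dirichlet_space \<omega> \<and>
      (\<forall>f\<in>dirichlet_space \<omega>. f w = dirichlet_inner \<omega> f (\<lambda>z. k z w)))"

end

theory Submission
  imports Defs "HOL-Complex_Analysis.Cauchy_Integral_Formula"
begin

text \<open>
  Consider harmonic functions on the disk, with the norm that adds the \<open>L\<^sup>2\<close> norm of the boundary
  values and the energy \<open>\<integral> \<bar>\<nabla>u\<bar>\<^sup>2 \<omega> dA\<close>. Splitting a harmonic function into a holomorphic and an
  antiholomorphic part is orthogonal for this norm, so the evaluation at \<open>w\<close> is represented by
  \<open>k(\<cdot>, w) + cnj (k(\<cdot>, w)) - 1 = 2 * Re (k(\<cdot>, w)) - 1\<close>; the 1 is the kernel of the constants, which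
  both parts contain. Let \<open>u\<close> be the boundary function of \<open>2 * Re (k(\<cdot>, w)) - 1\<close>.

  The Douglas formula makes the energy a Dirichlet form: it does not increase when \<open>u\<close> is replaced by
  \<open>\<bar>u\<bar>\<close> (\<open>douglas_weight_abs_contraction\<close>). Positivity of \<open>u\<close> then follows from the usual variational
  argument. Let \<open>P\<close> be the Poisson extension and \<open>E\<close> the bilinear form of the energy, as a form in the
  boundary values. The reproducing property expresses values at \<open>w\<close> as inner products with \<open>u\<close>:
  \<open>P[\<bar>u\<bar>](w) = \<integral> \<bar>u\<bar> u + E(\<bar>u\<bar>, u)\<close> and \<open>P[u](w) = \<integral> u\<^sup>2 + E(u, u)\<close>.
  The Poisson kernel is positive, so \<open>P[u](w) \<le> P[\<bar>u\<bar>](w)\<close>; the contraction gives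
  \<open>E(\<bar>u\<bar>, u) \<le> E(u, u)\<close> (\<open>dirichlet_form_le_diagonal\<close>). Hence \<open>\<integral> (u\<^sup>2 - \<bar>u\<bar> u) \<le> 0\<close>, which forces
  \<open>u \<ge> 0\<close> almost everywhere, and its Poisson extension \<open>2 * Re (k(\<cdot>, w)) - 1\<close> is nonnegative.

  The analytic work lies in the passage to the boundary. The kernel \<open>k(\<cdot>, w)\<close> belongs to the Hardy
  space, so its Taylor coefficients are square summable and belong to an \<open>L\<^sup>2\<close> function on the circle
  (\<open>riesz_fischer\<close>), while Hardy inner products are sums over coefficients
  (\<open>hardy_inner_eq_suminf\<close>) and therefore boundary integrals (\<open>boundary_real_function\<close>). In the other
  direction, \<open>\<bar>u\<bar>\<close> is not the real part of a function known in advance: its Szego projection supplies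
  the holomorphic function to which the reproducing property applies. The energy bound puts
  that function into the Dirichlet space, and thus into the Hardy space by hypothesis.
\<close>

section \<open>Completeness and products of square-integrable functions\<close>

text \<open>Along a subsequence \<open>N k\<close> with \<open>t (N k) \<le> 4\<^sup>-\<^sup>k\<close> the weighted series
  \<open>\<Sum>k. 2\<^sup>k \<bar>s (N (k + 1)) - s (N k)\<bar>\<^sup>2\<close> has finite integral, so it converges almost everywhere; by the
  arithmetic-geometric mean inequality so does \<open>\<Sum>k. \<bar>s (N (k + 1)) - s (N k)\<bar>\<close>. This gives a pointwise
  limit, and Fatou's lemma transfers the tail bounds to it. The weights \<open>2\<^sup>k\<close> make the argument work
  on every measure space, without comparing \<open>L\<^sup>1\<close> and \<open>L\<^sup>2\<close> norms.\<close>

lemma L2_complete: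
  fixes s :: "nat \<Rightarrow> 'a \<Rightarrow> 'b::{banach, second_countable_topology}"
  assumes meas [measurable]: "\<And>n. s n \<in> borel_measurable M"
    and t: "t \<longlonglongrightarrow> 0"
    and tail: "\<And>m n. m \<le> n \<Longrightarrow> (\<integral>\<^sup>+x. ennreal ((norm (s n x - s m x))\<^sup>2) \<partial>M) \<le> ennreal (t m)"
  shows "\<exists>f. f \<in> borel_measurable M \<and>
      (\<forall>m. (\<integral>\<^sup>+x. ennreal ((norm (f x - s m x))\<^sup>2) \<partial>M) \<le> ennreal (t m))"
proof -
  have "\<exists>N::nat\<Rightarrow>nat. \<forall>k. t (N k) \<le> (1/4)^k \<and> N k < N (Suc k)"
  proof (rule dependent_nat_choice)
    have ev: "\<forall>\<^sub>F n in sequentially. t n < (1/4)^k" for k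
      using order_tendstoD(2)[OF t, of "(1/4)^k"] by simp
    show "\<exists>x. t x \<le> (1/4)^0"
      using eventually_happens[OF ev[of 0]] by (auto intro: less_imp_le)
    show "\<exists>y. t y \<le> (1/4)^Suc n \<and> x < y" for x n
      using eventually_happens[OF eventually_conj[OF ev[of "Suc n"] eventually_gt_at_top[of x]]]
      by (auto intro: less_imp_le)
  qed
  then obtain N :: "nat \<Rightarrow> nat" where N: "\<And>k. t (N k) \<le> (1/4)^k" "\<And>k. N k < N (Suc k)"
    by blast
  have mono: "strict_mono N" using N(2) by (rule strict_monoI_Suc)
  define g where "g k x = s (N (Suc k)) x - s (N k) x" for k x
  have [measurable]: "g k \<in> borel_measurable M" for k
    unfolding g_def by measurable
  have g: "(\<integral>\<^sup>+x. ennreal (2^k * (norm (g k x))\<^sup>2) \<partial>M) \<le> ennreal ((1/2)^k)" for k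
  proof -
    have "(\<integral>\<^sup>+x. ennreal (2^k * (norm (g k x))\<^sup>2) \<partial>M) = ennreal (2^k) * (\<integral>\<^sup>+x. ennreal ((norm (g k x))\<^sup>2) \<partial>M)"
      by (subst nn_integral_cmult [symmetric]) (auto simp: ennreal_mult)
    also have "\<dots> \<le> ennreal (2^k) * ennreal (t (N k))"
      unfolding g_def using N(2)[of k] by (intro mult_left_mono tail) auto
    also have "\<dots> \<le> ennreal (2^k) * ennreal ((1/4)^k)"
      by (intro mult_left_mono ennreal_leI N) auto
    also have "\<dots> = ennreal ((1/2)^k)"
      by (simp add: ennreal_mult [symmetric] power_mult_distrib [symmetric])
    finally show ?thesis .
  qed
  have "(\<integral>\<^sup>+x. (\<Sum>k. ennreal (2^k * (norm (g k x))\<^sup>2)) \<partial>M) =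
      (\<Sum>k. \<integral>\<^sup>+x. ennreal (2^k * (norm (g k x))\<^sup>2) \<partial>M)"
    by (rule nn_integral_suminf) measurable
  also have "\<dots> \<le> (\<Sum>k. ennreal ((1/2)^k))"
    by (intro suminf_le g) auto
  also have "\<dots> < \<infinity>"
    by (subst suminf_ennreal2) (auto intro: summable_geometric)
  finally have "AE x in M. (\<Sum>k. ennreal (2^k * (norm (g k x))\<^sup>2)) \<noteq> \<infinity>"
    by (intro nn_integral_PInf_AE) auto
  then have AE_conv: "AE x in M. (\<lambda>k. s (N k) x) \<longlonglongrightarrow> lim (\<lambda>k. s (N k) x)"
  proof eventually_elim
    case (elim x)
    have sm: "summable (\<lambda>k. 2^k * (norm (g k x))\<^sup>2)"
      by (rule summable_suminf_not_top) (use elim in auto)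
    have "summable (\<lambda>k. (1/2)^k + 2^k * (norm (g k x))\<^sup>2)"
      by (intro summable_add sm summable_geometric) auto
    then have "summable (\<lambda>k. g k x)"
    proof (rule summable_comparison_test')
      fix k
      have "0 \<le> (1 - 2^k * norm (g k x))\<^sup>2" by simp
      then have "2 * (2^k * norm (g k x)) \<le> 1 + (2^k)\<^sup>2 * (norm (g k x))\<^sup>2"
        by (simp add: power2_diff power_mult_distrib)
      also have "\<dots> = 2^k * ((1/2)^k + 2^k * (norm (g k x))\<^sup>2)"
        by (simp add: field_simps power2_eq_square flip: power_mult_distrib)
      finally have "2 * norm (g k x) \<le> (1/2)^k + 2^k * (norm (g k x))\<^sup>2"
        by simp
      then show "norm (g k x) \<le> (1/2)^k + 2^k * (norm (g k x))\<^sup>2"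
        using norm_ge_zero[of "g k x"] by linarith
    qed
    then have "convergent (\<lambda>n. \<Sum>k<n. g k x)"
      by (simp add: summable_iff_convergent)
    moreover have "(\<Sum>k<n. g k x) = s (N n) x - s (N 0) x" for n
      unfolding g_def by (rule sum_lessThan_telescope)
    ultimately have "convergent (\<lambda>n. s (N n) x)"
      by (simp add: convergent_diff_const_right_iff)
    then show ?case by (simp add: convergent_LIMSEQ_iff)
  qed
  define f where "f x = lim (\<lambda>k. s (N k) x)" for x
  have [measurable]: "f \<in> borel_measurable M"
    unfolding f_def by (rule borel_measurable_lim_metric) measurable
  have "(\<integral>\<^sup>+x. ennreal ((norm (f x - s m x))\<^sup>2) \<partial>M) \<le> ennreal (t m)" for m
  proof -
    have "(\<integral>\<^sup>+x. ennreal ((norm (f x - s m x))\<^sup>2) \<partial>M) =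
      (\<integral>\<^sup>+x. liminf (\<lambda>k. ennreal ((norm (s (N k) x - s m x))\<^sup>2)) \<partial>M)"
    proof (rule nn_integral_cong_AE)
      show "AE x in M. ennreal ((norm (f x - s m x))\<^sup>2) =
          liminf (\<lambda>k. ennreal ((norm (s (N k) x - s m x))\<^sup>2))"
        using AE_conv
      proof eventually_elim
        case (elim x)
        then have "(\<lambda>k. ennreal ((norm (s (N k) x - s m x))\<^sup>2)) \<longlonglongrightarrow> ennreal ((norm (f x - s m x))\<^sup>2)"
          unfolding f_def by (intro tendsto_ennrealI tendsto_intros)
        then show ?case
          by (intro lim_imp_Liminf [symmetric]) simp_all
      qed
    qed
    also have "\<dots> \<le> liminf (\<lambda>k. \<integral>\<^sup>+x. ennreal ((norm (s (N k) x - s m x))\<^sup>2) \<partial>M)"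
      by (rule nn_integral_liminf) measurable
    also have "\<dots> \<le> limsup (\<lambda>k. \<integral>\<^sup>+x. ennreal ((norm (s (N k) x - s m x))\<^sup>2) \<partial>M)"
      by (rule Liminf_le_Limsup) simp
    also have "\<dots> \<le> ennreal (t m)"
    proof (rule Limsup_bounded)
      show "\<forall>\<^sub>F k in sequentially. (\<integral>\<^sup>+x. ennreal ((norm (s (N k) x - s m x))\<^sup>2) \<partial>M) \<le> ennreal (t m)"
        using eventually_ge_at_top[of m]
        by eventually_elim (rule tail[OF order_trans[OF _ seq_suble[OF mono]]])
    qed
    finally show ?thesis .
  qed
  then show ?thesis by (intro exI[of _ f]) simp
qed

lemma cmod_mult_le_sum_squares: "cmod a * cmod b \<le> (cmod a)\<^sup>2 + (cmod b)\<^sup>2"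
  using sum_squares_bound[of "cmod a" "cmod b"] mult_nonneg_nonneg[of "cmod a" "cmod b"]
  by (simp add: algebra_simps del: mult_nonneg_nonneg)

lemma integrable_mult_L2:
  fixes f g :: "'a \<Rightarrow> complex"
  assumes [measurable]: "f \<in> borel_measurable M" "g \<in> borel_measurable M"
    and "integrable M (\<lambda>x. (cmod (f x))\<^sup>2)" "integrable M (\<lambda>x. (cmod (g x))\<^sup>2)"
  shows "integrable M (\<lambda>x. f x * g x)"
proof (rule Bochner_Integration.integrable_bound)
  show "integrable M (\<lambda>x. (cmod (f x))\<^sup>2 + (cmod (g x))\<^sup>2)"
    using assms by auto
  show "AE x in M. norm (f x * g x) \<le> norm ((cmod (f x))\<^sup>2 + (cmod (g x))\<^sup>2)"
    by (simp add: norm_mult cmod_mult_le_sum_squares)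
qed simp

lemma cmod_diff_sq_le: "(cmod (a - b))\<^sup>2 \<le> 2 * (cmod a)\<^sup>2 + 2 * (cmod b)\<^sup>2"
proof -
  have "(cmod (a - b))\<^sup>2 \<le> (cmod a + cmod b)\<^sup>2"
    by (intro power_mono norm_triangle_ineq4) simp
  also have "\<dots> \<le> 2 * (cmod a)\<^sup>2 + 2 * (cmod b)\<^sup>2"
    using sum_squares_bound[of "cmod a" "cmod b"] by (simp add: power2_sum)
  finally show ?thesis .
qed

section \<open>Normalized Lebesgue measure on the circle\<close>

lemma sets_circle [measurable_cong]: "sets circle_measure = sets (restrict_space borel \<T>)"
  and space_circle [simp]: "space circle_measure = \<T>"
  by (auto simp: circle_measure_def space_restrict_space)

lemma measurable_cis: "cis \<in> borel \<rightarrow>\<^sub>M restrict_space borel \<T>"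
  by (rule measurable_restrict_space2)
     (auto intro!: borel_measurable_continuous_onI continuous_intros)

lemma finite_measure_circle: "finite_measure circle_measure"
proof
  have "emeasure circle_measure \<T> = emeasure (uniform_measure lborel {0..2*pi}) (cis -` \<T> \<inter> UNIV)"
    unfolding circle_measure_def
    by (subst emeasure_distr)
       (auto simp: sets_restrict_space intro!: measurable_cis[simplified] simp: uniform_measure_def)
  also have "cis -` \<T> \<inter> UNIV = (UNIV :: real set)" by auto
  also have "emeasure (uniform_measure lborel {0..2*pi}) UNIV = 1"
    by (subst emeasure_uniform_measure) (auto simp: ennreal_divide_self)
  finally show "emeasure circle_measure (space circle_measure) \<noteq> \<infinity>" by simp
qed

lemma continuous_measurable_circle:
  "continuous_on \<T> f \<Longrightarrow> f \<in> borel_measurable circle_measure"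
  using borel_measurable_continuous_on_restrict[of \<T> f]
  by (simp add: measurable_cong_sets[OF sets_circle refl])

lemma bounded_integrable_circle:
  fixes f :: "complex \<Rightarrow> 'a::{banach, second_countable_topology}"
  assumes "f \<in> borel_measurable circle_measure" "\<And>\<zeta>. \<zeta> \<in> \<T> \<Longrightarrow> norm (f \<zeta>) \<le> B"
  shows "integrable circle_measure f"
  using assms
  by (intro finite_measure.integrable_const_bound[OF finite_measure_circle, of _ B] AE_I2) auto

lemma continuous_integrable_circle:
  fixes f :: "complex \<Rightarrow> 'a::{banach, second_countable_topology}"
  assumes "continuous_on \<T> f"
  shows "integrable circle_measure f"
proof -
  have "bounded (f ` \<T>)"
    using assms by (intro compact_imp_bounded compact_continuous_image) auto
  then obtain B where "\<And>\<zeta>. \<zeta> \<in> \<T> \<Longrightarrow> norm (f \<zeta>) \<le> B"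
    unfolding bounded_iff by blast
  then show ?thesis
    by (intro bounded_integrable_circle continuous_measurable_circle assms) auto
qed

lemma circle_integral:
  fixes f :: "complex \<Rightarrow> complex"
  assumes [measurable]: "f \<in> borel_measurable circle_measure"
  shows "(LINT \<zeta>|circle_measure. f \<zeta>) =
    (\<integral>t. indicator {0..2*pi} t *\<^sub>R f (cis t) \<partial>lborel) / (2 * pi)"
proof -
  have u: "uniform_measure lborel {0..2*pi} = density lborel (\<lambda>t. ennreal (indicator {0..2*pi} t / (2*pi)))"
    unfolding uniform_measure_def
    by (intro density_cong) (auto simp: indicator_def divide_ennreal[symmetric] split: if_splits)
  have f': "f \<in> borel_measurable (restrict_space borel \<T>)"
    using assms by (simp add: measurable_cong_sets[OF sets_circle refl])
  have [measurable]: "(\<lambda>t. f (cis t)) \<in> borel_measurable borel"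
    using measurable_compose[OF measurable_cis f'] .
  have "(LINT \<zeta>|circle_measure. f \<zeta>) = (LINT t|uniform_measure lborel {0..2*pi}. f (cis t))"
    unfolding circle_measure_def using measurable_cis f'
    by (intro integral_distr) (auto simp: uniform_measure_def)
  also have "\<dots> = (\<integral>t. (indicator {0..2*pi} t / (2*pi)) *\<^sub>R f (cis t) \<partial>lborel)"
    unfolding u by (subst integral_density) auto
  also have "\<dots> = (\<integral>t. (indicator {0..2*pi} t *\<^sub>R f (cis t)) / (2*pi) \<partial>lborel)"
    by (intro Bochner_Integration.integral_cong) (auto simp: indicator_def scaleR_conv_of_real)
  also have "\<dots> = (\<integral>t. indicator {0..2*pi} t *\<^sub>R f (cis t) \<partial>lborel) / (2 * pi)"
    by simp
  finally show ?thesis .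
qed

lemma circle_orthonormal:
  "(LINT \<zeta>|circle_measure. \<zeta>^m * cnj \<zeta>^n) = (if m = n then 1 else 0)"
proof -
  define k where "k = real m - real n"
  have cis: "cis t ^ m * cnj (cis t) ^ n = cis (k * t)" for t
    by (simp add: k_def cis_cnj Complex.DeMoivre cis_mult algebra_simps)
  have "(LINT \<zeta>|circle_measure. \<zeta>^m * cnj \<zeta>^n) =
    (\<integral>t. indicator {0..2*pi} t *\<^sub>R (cis t ^ m * cnj (cis t) ^ n) \<partial>lborel) / (2 * pi)"
    by (rule circle_integral) (intro continuous_measurable_circle continuous_intros)
  also have "\<dots> = (\<integral>t. indicator {0..2*pi} t *\<^sub>R cis (k * t) \<partial>lborel) / (2 * pi)"
    by (simp add: cis)
  also have "(\<integral>t. indicator {0..2*pi} t *\<^sub>R cis (k * t) \<partial>lborel) = (if m = n then 2 * pi else 0)"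
  proof (cases "m = n")
    case True
    then show ?thesis by (simp add: k_def scaleR_conv_of_real)
  next
    case False
    then have k0: "k \<noteq> 0" by (simp add: k_def)
    have "(\<integral>t. indicator {0..2*pi} t *\<^sub>R cis (k * t) \<partial>lborel) =
      cis (k * (2*pi)) / (\<i> * k) - cis (k * 0) / (\<i> * k)"
    proof (rule integral_FTC_Icc)
      fix x
      have "cis (k * t) = exp (t *\<^sub>R (\<i> * k))" for t
        by (simp add: cis_conv_exp scaleR_conv_of_real mult_ac)
      then have "((\<lambda>t. cis (k * t)) has_vector_derivative (cis (k * x) * (\<i> * k))) (at x within {0..2*pi})"
        using exp_scaleR_has_vector_derivative_right[of "\<i> * k" x "{0..2*pi}"] by simp
      then have "((\<lambda>t. cis (k * t) / (\<i> * k)) has_vector_derivative (cis (k * x) * (\<i> * k)) / (\<i> * k)) (at x within {0..2*pi})"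
        by (rule has_vector_derivative_divide)
      then show "((\<lambda>t. cis (k * t) / (\<i> * k)) has_vector_derivative cis (k * x)) (at x within {0..2*pi})"
        using k0 by (simp add: scaleR_conv_of_real)
    qed (auto intro!: continuous_intros)
    also have "cis (k * (2*pi)) = 1"
      using cis_multiple_2pi[of "of_int (int m - int n)"] by (simp add: k_def mult_ac)
    finally show ?thesis using False by simp
  qed
  finally show ?thesis by simp
qed

section \<open>Fourier coefficients, Szego projection and Poisson extension\<close>

definition fourier_coeff :: "(complex \<Rightarrow> complex) \<Rightarrow> nat \<Rightarrow> complex"
  where "fourier_coeff f n = (LINT \<zeta>|circle_measure. f \<zeta> * cnj \<zeta> ^ n)"

text \<open>The Szego projection of \<open>f\<close>, as a Cauchy integral: its Taylor coefficients are the Fourier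
  coefficients of \<open>f\<close> with nonnegative index.\<close>

definition szego :: "(complex \<Rightarrow> complex) \<Rightarrow> complex \<Rightarrow> complex"
  where "szego f z = (LINT \<zeta>|circle_measure. f \<zeta> / (1 - z * cnj \<zeta>))"

lemma integrable_mult_continuous_circle:
  fixes g h :: "complex \<Rightarrow> complex"
  assumes g: "integrable circle_measure g" and h: "continuous_on \<T> h"
  shows "integrable circle_measure (\<lambda>\<zeta>. g \<zeta> * h \<zeta>)"
proof -
  have "bounded (h ` \<T>)"
    using h by (intro compact_imp_bounded compact_continuous_image) auto
  then obtain B where B: "\<And>\<zeta>. \<zeta> \<in> \<T> \<Longrightarrow> norm (h \<zeta>) \<le> B"
    unfolding bounded_iff by blast
  show ?thesis
  proof (rule Bochner_Integration.integrable_bound)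
    show "integrable circle_measure (\<lambda>\<zeta>. B *\<^sub>R g \<zeta>)" using g by simp
    show "(\<lambda>\<zeta>. g \<zeta> * h \<zeta>) \<in> borel_measurable circle_measure"
      using g continuous_measurable_circle[OF h] by simp
    show "AE \<zeta> in circle_measure. norm (g \<zeta> * h \<zeta>) \<le> norm (B *\<^sub>R g \<zeta>)"
    proof (rule AE_I2)
      fix \<zeta> assume "\<zeta> \<in> space circle_measure"
      then have "norm (h \<zeta>) \<le> \<bar>B\<bar>" using B[of \<zeta>] by simp
      then show "norm (g \<zeta> * h \<zeta>) \<le> norm (B *\<^sub>R g \<zeta>)"
        using mult_left_mono[of "norm (h \<zeta>)" "\<bar>B\<bar>" "norm (g \<zeta>)"] by (simp add: norm_mult mult.commute)
    qed
  qed
qed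

text \<open>The interchange of sum and integral behind both the expansion of the Cauchy kernel and Parseval's
  formula on a smaller circle, where the \<open>b n\<close> are Taylor coefficients.\<close>

lemma fourier_series_integral:
  assumes g: "integrable circle_measure g" and b: "summable (\<lambda>n. norm (b n))"
  shows "(\<lambda>n. b n * fourier_coeff g n) sums
    (LINT \<zeta>|circle_measure. g \<zeta> * (\<Sum>n. b n * cnj \<zeta> ^ n))"
proof -
  have int: "integrable circle_measure (\<lambda>\<zeta>. g \<zeta> * (b n * cnj \<zeta> ^ n))" for n
    by (intro integrable_mult_continuous_circle g continuous_intros)
  have "(\<lambda>n. LINT \<zeta>|circle_measure. g \<zeta> * (b n * cnj \<zeta> ^ n)) sums
    (LINT \<zeta>|circle_measure. (\<Sum>n. g \<zeta> * (b n * cnj \<zeta> ^ n)))"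
  proof (rule sums_integral)
    show "AE \<zeta> in circle_measure. summable (\<lambda>n. norm (g \<zeta> * (b n * cnj \<zeta> ^ n)))"
      by (rule AE_I2) (simp add: norm_mult norm_power summable_mult b)
    have "(LINT \<zeta>|circle_measure. norm (g \<zeta> * (b n * cnj \<zeta> ^ n))) =
        (LINT \<zeta>|circle_measure. norm (g \<zeta>)) * norm (b n)" for n
      by (subst integral_mult_left_zero [symmetric], rule Bochner_Integration.integral_cong)
        (simp_all add: norm_mult norm_power)
    then show "summable (\<lambda>n. LINT \<zeta>|circle_measure. norm (g \<zeta> * (b n * cnj \<zeta> ^ n)))"
      using summable_mult[OF b] by simp
  qed (rule int)
  moreover have "(LINT \<zeta>|circle_measure. g \<zeta> * (b n * cnj \<zeta> ^ n)) = b n * fourier_coeff g n" for n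
    unfolding fourier_coeff_def by (subst integral_mult_right_zero [symmetric]) (simp add: mult_ac)
  moreover have "(LINT \<zeta>|circle_measure. (\<Sum>n. g \<zeta> * (b n * cnj \<zeta> ^ n))) =
    (LINT \<zeta>|circle_measure. g \<zeta> * (\<Sum>n. b n * cnj \<zeta> ^ n))"
  proof (intro Bochner_Integration.integral_cong refl suminf_mult)
    fix \<zeta> assume "\<zeta> \<in> space circle_measure"
    then have "summable (\<lambda>n. norm (b n * cnj \<zeta> ^ n))"
      by (simp add: norm_mult norm_power b)
    then show "summable (\<lambda>n. b n * cnj \<zeta> ^ n)"
      by (rule summable_norm_cancel)
  qed
  ultimately show ?thesis by simp
qed

lemma szego_sums:
  assumes f: "integrable circle_measure f" and z: "z \<in> \<D>"
  shows "(\<lambda>n. fourier_coeff f n * z ^ n) sums szego f z"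
proof -
  have "(\<lambda>n. z ^ n * fourier_coeff f n) sums
    (LINT \<zeta>|circle_measure. f \<zeta> * (\<Sum>n. z ^ n * cnj \<zeta> ^ n))"
    using f z by (intro fourier_series_integral) (simp_all add: norm_power summable_geometric)
  also have "(LINT \<zeta>|circle_measure. f \<zeta> * (\<Sum>n. z ^ n * cnj \<zeta> ^ n)) = szego f z"
    unfolding szego_def
  proof (intro Bochner_Integration.integral_cong refl)
    fix \<zeta> assume "\<zeta> \<in> space circle_measure"
    then have "norm (z * cnj \<zeta>) < 1" using z by (simp add: norm_mult)
    then show "f \<zeta> * (\<Sum>n. z ^ n * cnj \<zeta> ^ n) = f \<zeta> / (1 - z * cnj \<zeta>)"
      by (simp add: suminf_geometric flip: power_mult_distrib)
  qed
  finally show ?thesis by (simp add: mult.commute)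
qed

lemma holomorphic_szego:
  "integrable circle_measure f \<Longrightarrow> szego f holomorphic_on \<D>"
  using szego_sums[of f] by (intro power_series_holomorphic[where a = "fourier_coeff f"]) simp

lemma poisson_kernel_eq:
  assumes "z \<in> \<D>" "\<zeta> \<in> \<T>"
  shows "(1 - (cmod z)\<^sup>2) / (cmod (\<zeta> - z))\<^sup>2 = 2 * Re (1 / (1 - z * cnj \<zeta>)) - 1"
proof -
  define q where "q = 1 - z * cnj \<zeta>"
  have "norm (z * cnj \<zeta>) < 1" using assms by (simp add: norm_mult)
  then have "q \<noteq> 0" unfolding q_def by auto
  have \<zeta>: "\<zeta> * cnj \<zeta> = 1" using assms by (simp add: complex_norm_square [symmetric])
  have "\<zeta> - z = \<zeta> * q"
    unfolding q_def using \<zeta> by (simp add: algebra_simps)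
  then have 1: "(cmod (\<zeta> - z))\<^sup>2 = (cmod q)\<^sup>2" using assms by (simp add: norm_mult)
  have "(cmod (1 - q))\<^sup>2 = (cmod z)\<^sup>2" using assms by (simp add: q_def norm_mult)
  then have 2: "1 - (cmod z)\<^sup>2 = 2 * Re q - (cmod q)\<^sup>2"
    unfolding cmod_power2 by (simp add: power2_eq_square algebra_simps)
  have "Re (1 / q) = Re q / (cmod q)\<^sup>2"
    by (simp add: Re_divide cmod_power2)
  then show ?thesis
    unfolding 1 2 q_def[symmetric] using \<open>q \<noteq> 0\<close> by (simp add: field_simps)
qed

lemma Re_complex_of_real_mult: "Re (complex_of_real x * w) = x * Re w"
  by simp

text \<open>For real data the negative Fourier coefficients are the conjugates of the positive ones, so the
  Poisson extension is determined by the Szego projection; on the level of kernels this is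
  \<open>poisson_kernel_eq\<close>.\<close>

lemma poisson_extension_eq_szego:
  fixes u :: "complex \<Rightarrow> real"
  assumes u: "integrable circle_measure u" and z: "z \<in> \<D>"
  shows "poisson_extension (\<lambda>\<zeta>. complex_of_real (u \<zeta>)) z =
    complex_of_real (2 * Re (szego (\<lambda>\<zeta>. complex_of_real (u \<zeta>)) z) - (LINT \<zeta>|circle_measure. u \<zeta>))"
proof -
  have nz: "1 - z * cnj \<zeta> \<noteq> 0" if "\<zeta> \<in> \<T>" for \<zeta>
  proof -
    have "norm (z * cnj \<zeta>) < 1" using z that by (simp add: norm_mult)
    then show ?thesis by auto
  qed
  have int: "integrable circle_measure (\<lambda>\<zeta>. complex_of_real (u \<zeta>) * (1 / (1 - z * cnj \<zeta>)))"
    using u nz by (intro integrable_mult_continuous_circle continuous_intros) auto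
  have "poisson_extension (\<lambda>\<zeta>. complex_of_real (u \<zeta>)) z =
      (LINT \<zeta>|circle_measure. complex_of_real (2 * Re (complex_of_real (u \<zeta>) * (1 / (1 - z * cnj \<zeta>))) - u \<zeta>))"
    unfolding poisson_extension_def
  proof (intro Bochner_Integration.integral_cong refl)
    fix \<zeta> assume "\<zeta> \<in> space circle_measure"
    then have *: "(1 - (cmod z)\<^sup>2) / (cmod (\<zeta> - z))\<^sup>2 = 2 * Re (1 / (1 - z * cnj \<zeta>)) - 1"
      using z by (intro poisson_kernel_eq) auto
    show "((1 - (cmod z)\<^sup>2) / (cmod (\<zeta> - z))\<^sup>2) *\<^sub>R complex_of_real (u \<zeta>) =
      complex_of_real (2 * Re (complex_of_real (u \<zeta>) * (1 / (1 - z * cnj \<zeta>))) - u \<zeta>)"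
      unfolding * Re_complex_of_real_mult
      by (simp add: scaleR_conv_of_real algebra_simps)
  qed
  also have "\<dots> = complex_of_real (LINT \<zeta>|circle_measure. 2 * Re (complex_of_real (u \<zeta>) * (1 / (1 - z * cnj \<zeta>))) - u \<zeta>)"
    by (rule integral_complex_of_real)
  also have "(LINT \<zeta>|circle_measure. 2 * Re (complex_of_real (u \<zeta>) * (1 / (1 - z * cnj \<zeta>))) - u \<zeta>) =
    2 * (LINT \<zeta>|circle_measure. Re (complex_of_real (u \<zeta>) * (1 / (1 - z * cnj \<zeta>)))) - (LINT \<zeta>|circle_measure. u \<zeta>)"
    by (subst Bochner_Integration.integral_diff) (use int u in auto)
  also have "(LINT \<zeta>|circle_measure. Re (complex_of_real (u \<zeta>) * (1 / (1 - z * cnj \<zeta>)))) =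
      Re (szego (\<lambda>\<zeta>. complex_of_real (u \<zeta>)) z)"
    unfolding szego_def by (subst integral_Re[OF int]) simp
  finally show ?thesis .
qed

text \<open>For \<open>u = F + cnj F - c\<close> with \<open>F\<close> holomorphic, the two Wirtinger derivatives are \<open>F'\<close> and its
  conjugate, so both contribute \<open>\<bar>F'\<bar>\<^sup>2\<close>.\<close>

lemma grad_norm_sq_Re:
  assumes F: "F holomorphic_on \<D>" and z: "z \<in> \<D>"
    and u: "\<And>z. z \<in> \<D> \<Longrightarrow> u z = complex_of_real (2 * Re (F z) - c)"
  shows "grad_norm_sq u z = 2 * (cmod (deriv F z))\<^sup>2"
proof -
  have "(F has_derivative (\<lambda>h. deriv F z * h)) (at z)"
    using holomorphic_derivI[OF F open_ball z] by (rule has_field_derivative_imp_has_derivative)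
  then have "((\<lambda>z. complex_of_real (2 * Re (F z) - c)) has_derivative
      (\<lambda>h. complex_of_real (2 * Re (deriv F z * h)))) (at z)"
    by (auto intro!: derivative_eq_intros)
  then have "(u has_derivative (\<lambda>h. complex_of_real (2 * Re (deriv F z * h)))) (at z)"
    by (rule has_derivative_transform_within_open[OF _ open_ball z]) (simp add: u)
  then have "frechet_derivative u (at z) = (\<lambda>h. complex_of_real (2 * Re (deriv F z * h)))"
    by (rule frechet_derivative_at [symmetric])
  then have "wirtinger_d u z = deriv F z" "wirtinger_dbar u z = cnj (deriv F z)"
    by (simp_all add: wirtinger_d_def wirtinger_dbar_def complex_eq_iff)
  then show ?thesis by (simp add: grad_norm_sq_def)
qed

section \<open>Taylor coefficients and the Hardy space\<close>

lemma power_series_abs_summable: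
  fixes a :: "nat \<Rightarrow> complex"
  assumes "\<And>z. z \<in> \<D> \<Longrightarrow> (\<lambda>n. a n * z ^ n) sums F z" and "0 \<le> r" "r < 1"
  shows "summable (\<lambda>n. norm (a n * complex_of_real r ^ n))"
proof -
  obtain s where s: "r < s" "s < 1" using dense assms(3) by blast
  then have "summable (\<lambda>n. a n * complex_of_real s ^ n)"
    using assms by (intro sums_summable[OF assms(1)]) auto
  then show ?thesis
    by (rule powser_insidea) (use s assms in auto)
qed

lemma cnj_power_series_circle:
  fixes a :: "nat \<Rightarrow> complex"
  assumes a: "\<And>z. z \<in> \<D> \<Longrightarrow> (\<lambda>n. a n * z ^ n) sums F z" and r: "0 \<le> r" "r < 1" and "\<zeta> \<in> \<T>"
  shows "(\<Sum>n. (cnj (a n) * complex_of_real r ^ n) * cnj \<zeta> ^ n) = cnj (F (complex_of_real r * \<zeta>))"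
proof -
  have "(\<lambda>n. cnj (a n * (complex_of_real r * \<zeta>) ^ n)) sums cnj (F (complex_of_real r * \<zeta>))"
    unfolding sums_cnj using assms by (intro a) (auto simp: norm_mult)
  then show ?thesis
    by (simp add: sums_iff power_mult_distrib mult_ac)
qed

lemma continuous_on_circle_dilate:
  assumes F: "F holomorphic_on \<D>" and r: "0 \<le> r" "r < 1"
  shows "continuous_on \<T> (\<lambda>\<zeta>. F (complex_of_real r * \<zeta>))"
  by (rule continuous_on_compose2[OF holomorphic_on_imp_continuous_on[OF F]])
     (use r in \<open>auto intro!: continuous_intros simp: norm_mult\<close>)

lemma power_series_holomorphic_disk:
  fixes a :: "nat \<Rightarrow> complex"
  assumes "\<And>z. z \<in> \<D> \<Longrightarrow> (\<lambda>n. a n * z ^ n) sums F z"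
  shows "F holomorphic_on \<D>"
  using assms by (intro power_series_holomorphic[where a = a]) simp

lemma fourier_coeff_monomial: "fourier_coeff (\<lambda>\<zeta>. \<zeta> ^ n) m = (if n = m then 1 else 0)"
  unfolding fourier_coeff_def by (rule circle_orthonormal)

lemma fourier_coeff_dilate:
  fixes a :: "nat \<Rightarrow> complex"
  assumes a: "\<And>z. z \<in> \<D> \<Longrightarrow> (\<lambda>n. a n * z ^ n) sums F z" and r: "0 \<le> r" "r < 1"
  shows "fourier_coeff (\<lambda>\<zeta>. F (complex_of_real r * \<zeta>)) n = a n * complex_of_real r ^ n"
proof -
  let ?b = "\<lambda>m. cnj (a m) * complex_of_real r ^ m"
  have "(\<lambda>m. ?b m * fourier_coeff (\<lambda>\<zeta>. \<zeta> ^ n) m) sums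
    (LINT \<zeta>|circle_measure. \<zeta> ^ n * (\<Sum>m. ?b m * cnj \<zeta> ^ m))"
    using power_series_abs_summable[OF a r]
    by (intro fourier_series_integral continuous_integrable_circle continuous_intros)
       (simp_all add: norm_mult)
  moreover have "(\<lambda>m. ?b m * fourier_coeff (\<lambda>\<zeta>. \<zeta> ^ n) m) = (\<lambda>m. if m = n then ?b m else 0)"
    by (auto simp: fourier_coeff_monomial)
  ultimately have "?b n = (LINT \<zeta>|circle_measure. \<zeta> ^ n * (\<Sum>m. ?b m * cnj \<zeta> ^ m))"
    using sums_single[of n ?b] by (simp add: sums_iff)
  also have "\<dots> = (LINT \<zeta>|circle_measure. cnj (F (complex_of_real r * \<zeta>) * cnj \<zeta> ^ n))"
    by (intro Bochner_Integration.integral_cong refl) (use cnj_power_series_circle[OF a r] in \<open>simp add: mult.commute\<close>)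
  also have "\<dots> = cnj (fourier_coeff (\<lambda>\<zeta>. F (complex_of_real r * \<zeta>)) n)"
    unfolding fourier_coeff_def by (rule Bochner_Integration.integral_cnj)
  finally show ?thesis
    by (metis complex_cnj_cnj complex_cnj_complex_of_real complex_cnj_mult complex_cnj_power)
qed

lemma power_series_parseval:
  fixes a b :: "nat \<Rightarrow> complex"
  assumes a: "\<And>z. z \<in> \<D> \<Longrightarrow> (\<lambda>n. a n * z ^ n) sums F z"
    and b: "\<And>z. z \<in> \<D> \<Longrightarrow> (\<lambda>n. b n * z ^ n) sums G z" and r: "0 \<le> r" "r < 1"
  shows "(\<lambda>n. complex_of_real (r ^ (2 * n)) * (a n * cnj (b n))) sums
    (LINT \<zeta>|circle_measure. F (complex_of_real r * \<zeta>) * cnj (G (complex_of_real r * \<zeta>)))"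
proof -
  have "(\<lambda>n. (cnj (b n) * complex_of_real r ^ n) * fourier_coeff (\<lambda>\<zeta>. F (complex_of_real r * \<zeta>)) n) sums
    (LINT \<zeta>|circle_measure. F (complex_of_real r * \<zeta>) * (\<Sum>n. (cnj (b n) * complex_of_real r ^ n) * cnj \<zeta> ^ n))"
    using power_series_abs_summable[OF b r] power_series_holomorphic_disk[OF a] r
    by (intro fourier_series_integral continuous_integrable_circle continuous_on_circle_dilate)
       (simp_all add: norm_mult)
  moreover have "(LINT \<zeta>|circle_measure. F (complex_of_real r * \<zeta>) * (\<Sum>n. (cnj (b n) * complex_of_real r ^ n) * cnj \<zeta> ^ n)) =
    (LINT \<zeta>|circle_measure. F (complex_of_real r * \<zeta>) * cnj (G (complex_of_real r * \<zeta>)))"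
    by (intro Bochner_Integration.integral_cong refl) (use cnj_power_series_circle[OF b r] in simp)
  moreover have "(cnj (b n) * complex_of_real r ^ n) * fourier_coeff (\<lambda>\<zeta>. F (complex_of_real r * \<zeta>)) n =
      complex_of_real (r ^ (2 * n)) * (a n * cnj (b n))" for n
    by (subst fourier_coeff_dilate[of a F r n])
       (use a r in \<open>simp_all add: mult_ac power_mult power2_eq_square power_mult_distrib\<close>)
  ultimately show ?thesis by simp
qed

text \<open>By Parseval the integral means of \<open>\<bar>F\<bar>\<^sup>2\<close> are \<open>\<Sum>n. r\<^sup>2\<^sup>n \<bar>a n\<bar>\<^sup>2\<close>. Each finite partial sum keeps the
  bound as \<open>r\<close> tends to 1.\<close>

lemma hardy_space_imp_square_summable:
  fixes a :: "nat \<Rightarrow> complex"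
  assumes a: "\<And>z. z \<in> \<D> \<Longrightarrow> (\<lambda>n. a n * z ^ n) sums F z" and F: "F \<in> hardy_space"
  shows "summable (\<lambda>n. (cmod (a n))\<^sup>2)"
proof -
  obtain B where B: "\<And>r. 0 \<le> r \<Longrightarrow> r < 1 \<Longrightarrow>
      (LINT \<zeta>|circle_measure. (cmod (F (complex_of_real r * \<zeta>)))\<^sup>2) \<le> B"
    using F unfolding hardy_space_def bdd_above_def by fastforce
  have part: "(\<Sum>n<N. r ^ (2 * n) * (cmod (a n))\<^sup>2) \<le> B" if r: "0 \<le> r" "r < 1" for r N
  proof -
    have "(\<lambda>n. complex_of_real (r ^ (2 * n) * (cmod (a n))\<^sup>2)) sums
      (LINT \<zeta>|circle_measure. complex_of_real ((cmod (F (complex_of_real r * \<zeta>)))\<^sup>2))"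
      using power_series_parseval[OF a a r] by (simp flip: complex_norm_square)
    then have "(\<lambda>n. r ^ (2 * n) * (cmod (a n))\<^sup>2) sums
      (LINT \<zeta>|circle_measure. (cmod (F (complex_of_real r * \<zeta>)))\<^sup>2)"
      unfolding integral_complex_of_real sums_of_real_iff .
    then have "(\<Sum>n<N. r ^ (2 * n) * (cmod (a n))\<^sup>2) \<le> (LINT \<zeta>|circle_measure. (cmod (F (complex_of_real r * \<zeta>)))\<^sup>2)"
      using r sum_le_suminf[of "\<lambda>n. r ^ (2 * n) * (cmod (a n))\<^sup>2" "{..<N}"] by (simp add: sums_iff)
    then show ?thesis using B[OF r] by linarith
  qed
  have "(\<Sum>n<N. (cmod (a n))\<^sup>2) \<le> B" for N
  proof (rule tendsto_upperbound)
    have "((\<lambda>r. \<Sum>n<N. r ^ (2 * n) * (cmod (a n))\<^sup>2) \<longlongrightarrow> (\<Sum>n<N. 1 ^ (2 * n) * (cmod (a n))\<^sup>2)) (at_left (1::real))"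
      by (intro tendsto_intros)
    then show "((\<lambda>r. \<Sum>n<N. r ^ (2 * n) * (cmod (a n))\<^sup>2) \<longlongrightarrow> (\<Sum>n<N. (cmod (a n))\<^sup>2)) (at_left (1::real))"
      by simp
    show "\<forall>\<^sub>F r in at_left (1::real). (\<Sum>n<N. r ^ (2 * n) * (cmod (a n))\<^sup>2) \<le> B"
      using eventually_at_left_real[of 0 1] by (auto elim!: eventually_mono intro!: part)
  qed simp
  then show ?thesis by (intro summableI_nonneg_bounded) auto
qed

lemma summable_mult_square_summable:
  fixes a b :: "nat \<Rightarrow> complex"
  assumes "summable (\<lambda>n. (cmod (a n))\<^sup>2)" "summable (\<lambda>n. (cmod (b n))\<^sup>2)"
  shows "summable (\<lambda>n. norm (a n * cnj (b n)))"
proof (rule summable_comparison_test'[OF summable_add[OF assms]])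
  fix n
  show "norm (norm (a n * cnj (b n))) \<le> (cmod (a n))\<^sup>2 + (cmod (b n))\<^sup>2"
    using cmod_mult_le_sum_squares[of "a n" "b n"] by (simp add: norm_mult)
qed

text \<open>The limit defining the Hardy inner product exists and may be taken term by term: the series is
  dominated by \<open>\<Sum>n. \<bar>a n\<bar> \<bar>b n\<bar>\<close>, so Tannery's theorem applies.\<close>

lemma hardy_inner_eq_suminf:
  fixes a b :: "nat \<Rightarrow> complex"
  assumes a: "\<And>z. z \<in> \<D> \<Longrightarrow> (\<lambda>n. a n * z ^ n) sums F z" and F: "F \<in> hardy_space"
    and b: "\<And>z. z \<in> \<D> \<Longrightarrow> (\<lambda>n. b n * z ^ n) sums G z" and G: "G \<in> hardy_space"
  shows "(\<lambda>n. a n * cnj (b n)) sums hardy_inner F G"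
proof -
  have ab: "summable (\<lambda>n. norm (a n * cnj (b n)))"
    by (intro summable_mult_square_summable hardy_space_imp_square_summable[OF a F]
        hardy_space_imp_square_summable[OF b G])
  have near: "\<forall>\<^sub>F r in at_left (1::real). r \<in> {0<..<1}"
    by (rule eventually_at_left_real) simp
  have lim: "((\<lambda>r. \<Sum>n. complex_of_real (r ^ (2 * n)) * (a n * cnj (b n))) \<longlongrightarrow>
      (\<Sum>n. a n * cnj (b n))) (at_left (1::real))"
  proof (rule tannerys_theorem[THEN conjunct2, THEN conjunct2, OF _ _ ab])
    fix n
    have "((\<lambda>r. complex_of_real (r ^ (2 * n)) * (a n * cnj (b n))) \<longlongrightarrow>
      complex_of_real (1 ^ (2 * n)) * (a n * cnj (b n))) (at_left (1::real))"
      by (intro tendsto_intros)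
    then show "((\<lambda>r. complex_of_real (r ^ (2 * n)) * (a n * cnj (b n))) \<longlongrightarrow> a n * cnj (b n)) (at_left (1::real))"
      by simp
  next
    show "\<forall>\<^sub>F (n, r) in at_top \<times>\<^sub>F at_left (1::real).
        norm (complex_of_real (r ^ (2 * n)) * (a n * cnj (b n))) \<le> norm (a n * cnj (b n))"
    proof (rule eventually_mono[OF eventually_prodI[OF always_eventually near, of "\<lambda>_. True"]])
      fix x :: "nat \<times> real"
      assume "True \<and> snd x \<in> {0<..<1}"
      then have "\<bar>snd x ^ (2 * fst x)\<bar> \<le> 1"
        by (simp add: power_abs power_le_one)
      then show "case x of (n, r) \<Rightarrow> norm (complex_of_real (r ^ (2 * n)) * (a n * cnj (b n))) \<le> norm (a n * cnj (b n))"
        by (cases x) (simp add: norm_mult mult_left_le_one_le norm_power power_abs)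
    qed simp
  qed simp
  have "((\<lambda>r. LINT \<zeta>|circle_measure. F (complex_of_real r * \<zeta>) * cnj (G (complex_of_real r * \<zeta>))) \<longlongrightarrow>
      (\<Sum>n. a n * cnj (b n))) (at_left (1::real))"
  proof (rule Lim_transform_eventually[OF lim])
    show "\<forall>\<^sub>F r in at_left (1::real). (\<Sum>n. complex_of_real (r ^ (2 * n)) * (a n * cnj (b n))) =
      (LINT \<zeta>|circle_measure. F (complex_of_real r * \<zeta>) * cnj (G (complex_of_real r * \<zeta>)))"
      using near by eventually_elim (use power_series_parseval[OF a b] in \<open>simp add: sums_iff\<close>)
  qed
  then have "hardy_inner F G = (\<Sum>n. a n * cnj (b n))"
    unfolding hardy_inner_def by (intro tendsto_Lim) auto
  then show ?thesis
    using summable_sums[OF summable_norm_cancel[OF ab]] by simp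
qed

section \<open>Boundary functions\<close>

lemma L2_circle_continuous: "continuous_on \<T> f \<Longrightarrow> f \<in> L2_circle"
  unfolding L2_circle_def
  by (auto intro!: continuous_measurable_circle continuous_integrable_circle continuous_intros)

lemma L2_circle_integrable:
  assumes "f \<in> L2_circle"
  shows "integrable circle_measure f"
proof -
  have f: "f \<in> borel_measurable circle_measure" "integrable circle_measure (\<lambda>\<zeta>. (cmod (f \<zeta>))\<^sup>2)"
    using assms by (auto simp: L2_circle_def)
  have "integrable circle_measure (\<lambda>\<zeta>. cmod (f \<zeta>))"
    by (rule finite_measure.square_integrable_imp_integrable[OF finite_measure_circle _ f(2)])
       (use f(1) in measurable)
  then show ?thesis by (simp only: integrable_norm_iff[OF f(1)])
qed

lemma L2_circle_cnj: "f \<in> L2_circle \<Longrightarrow> (\<lambda>\<zeta>. cnj (f \<zeta>)) \<in> L2_circle"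
  by (auto simp: L2_circle_def intro!: measurable_compose[OF _ borel_measurable_continuous_onI, of _ _ cnj]
      continuous_intros)

lemma L2_circle_mult_integrable:
  "f \<in> L2_circle \<Longrightarrow> g \<in> L2_circle \<Longrightarrow> integrable circle_measure (\<lambda>\<zeta>. f \<zeta> * g \<zeta>)"
  unfolding L2_circle_def by (auto intro: integrable_mult_L2)

lemma L2_circle_diff:
  assumes "f \<in> L2_circle" "g \<in> L2_circle"
  shows "(\<lambda>\<zeta>. f \<zeta> - g \<zeta>) \<in> L2_circle"
proof -
  have [measurable]: "f \<in> borel_measurable circle_measure" "g \<in> borel_measurable circle_measure"
    using assms by (auto simp: L2_circle_def)
  have "integrable circle_measure (\<lambda>\<zeta>. (cmod (f \<zeta> - g \<zeta>))\<^sup>2)"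
  proof (rule Bochner_Integration.integrable_bound)
    show "integrable circle_measure (\<lambda>\<zeta>. 2 * (cmod (f \<zeta>))\<^sup>2 + 2 * (cmod (g \<zeta>))\<^sup>2)"
      using assms by (auto simp: L2_circle_def)
  qed (auto intro!: AE_I2 cmod_diff_sq_le)
  then show ?thesis by (simp add: L2_circle_def)
qed

lemma L2_circle_add:
  "f \<in> L2_circle \<Longrightarrow> g \<in> L2_circle \<Longrightarrow> (\<lambda>\<zeta>. f \<zeta> + g \<zeta>) \<in> L2_circle"
  using L2_circle_diff[of f "\<lambda>\<zeta>. - g \<zeta>"] by (simp add: L2_circle_def)

lemma L2_circle_abs:
  fixes u :: "complex \<Rightarrow> real"
  assumes "(\<lambda>\<zeta>. complex_of_real (u \<zeta>)) \<in> L2_circle"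
  shows "(\<lambda>\<zeta>. complex_of_real \<bar>u \<zeta>\<bar>) \<in> L2_circle"
proof -
  have f: "(\<lambda>\<zeta>. complex_of_real (u \<zeta>)) \<in> borel_measurable circle_measure"
    using assms by (simp add: L2_circle_def)
  have "u \<in> borel_measurable circle_measure"
    using measurable_compose[OF f borel_measurable_continuous_onI[of Re]]
    by (simp add: continuous_on_Re continuous_on_id)
  then show ?thesis using assms by (simp add: L2_circle_def)
qed

lemma norm_trig_polynomial_sq:
  "(LINT \<zeta>|circle_measure. (cmod (\<Sum>i\<in>A. a i * \<zeta> ^ i))\<^sup>2) = (\<Sum>i\<in>A. (cmod (a i))\<^sup>2)"
proof (cases "finite A")
  case True
  have "complex_of_real (LINT \<zeta>|circle_measure. (cmod (\<Sum>i\<in>A. a i * \<zeta> ^ i))\<^sup>2) =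
    (LINT \<zeta>|circle_measure. (\<Sum>i\<in>A. \<Sum>j\<in>A. (a i * cnj (a j)) * (\<zeta> ^ i * cnj \<zeta> ^ j)))"
    unfolding integral_complex_of_real [symmetric] complex_norm_square cnj_sum sum_product
    by (simp add: mult_ac)
  also have "\<dots> = (\<Sum>i\<in>A. \<Sum>j\<in>A. (a i * cnj (a j)) * (if i = j then 1 else 0))"
    by (subst Bochner_Integration.integral_sum,
        (intro continuous_integrable_circle continuous_intros)[1],
        rule sum.cong[OF refl], subst Bochner_Integration.integral_sum,
        (intro continuous_integrable_circle continuous_intros)[1])
       (simp add: circle_orthonormal)
  also have "\<dots> = complex_of_real (\<Sum>i\<in>A. (cmod (a i))\<^sup>2)"
    using True by (simp add: sum.delta' complex_norm_square mult_if_delta if_distrib[where f = "\<lambda>x. _ * x"] cong: if_cong del: of_real_power)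
  finally show ?thesis by (simp only: of_real_eq_iff)
qed simp

text \<open>The boundary function with Fourier coefficients \<open>a n\<close> is the \<open>L\<^sup>2\<close> limit of the trigonometric
  polynomials \<open>\<Sum>n<N. a n * \<zeta> ^ n\<close>. It is described through its pairing with arbitrary \<open>g\<close>, which
  passes to the limit by Cauchy-Schwarz; taking powers of \<open>\<zeta>\<close> and of \<open>cnj \<zeta>\<close> for \<open>g\<close>
  recovers its Fourier coefficients of either sign.\<close>

lemma riesz_fischer:
  fixes a :: "nat \<Rightarrow> complex"
  assumes a: "summable (\<lambda>n. (cmod (a n))\<^sup>2)"
  shows "\<exists>f\<in>L2_circle. \<forall>g\<in>L2_circle.
    (\<lambda>n. fourier_coeff g n * cnj (a n)) sums (LINT \<zeta>|circle_measure. g \<zeta> * cnj (f \<zeta>))"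
proof -
  define s where "s N \<zeta> = (\<Sum>n<N. a n * \<zeta> ^ n)" for N \<zeta>
  define t where "t m = (\<Sum>n. (cmod (a n))\<^sup>2) - (\<Sum>n<m. (cmod (a n))\<^sup>2)" for m
  have t0: "0 \<le> t m" for m
    unfolding t_def using sum_le_suminf[OF a, of "{..<m}"] by simp
  have s_L2: "s N \<in> L2_circle" for N
    unfolding s_def by (intro L2_circle_continuous continuous_intros)
  then have [measurable]: "s N \<in> borel_measurable circle_measure" for N
    by (simp add: L2_circle_def)
  have "\<exists>f. f \<in> borel_measurable circle_measure \<and>
      (\<forall>m. (\<integral>\<^sup>+\<zeta>. ennreal ((cmod (f \<zeta> - s m \<zeta>))\<^sup>2) \<partial>circle_measure) \<le> ennreal (t m))"
  proof (rule L2_complete)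
    have "t \<longlonglongrightarrow> (\<Sum>n. (cmod (a n))\<^sup>2) - (\<Sum>n. (cmod (a n))\<^sup>2)"
      unfolding t_def by (intro tendsto_diff tendsto_const summable_LIMSEQ a)
    then show "t \<longlonglongrightarrow> 0" by simp
  next
    fix m n :: nat assume "m \<le> n"
    have diff: "s n \<zeta> - s m \<zeta> = (\<Sum>i\<in>{m..<n}. a i * \<zeta> ^ i)" for \<zeta>
      unfolding s_def lessThan_atLeast0 using \<open>m \<le> n\<close> by (simp add: sum_diff_nat_ivl)
    have "(\<integral>\<^sup>+\<zeta>. ennreal ((cmod (s n \<zeta> - s m \<zeta>))\<^sup>2) \<partial>circle_measure) = ennreal (\<Sum>i\<in>{m..<n}. (cmod (a i))\<^sup>2)"
      unfolding diff norm_trig_polynomial_sq [symmetric]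
      by (intro nn_integral_eq_integral continuous_integrable_circle continuous_intros) auto
    also have "\<dots> \<le> ennreal (t m)"
    proof (rule ennreal_leI)
      have "(\<Sum>i<m. (cmod (a i))\<^sup>2) + (\<Sum>i\<in>{m..<n}. (cmod (a i))\<^sup>2) = (\<Sum>i<n. (cmod (a i))\<^sup>2)"
        unfolding lessThan_atLeast0 using \<open>m \<le> n\<close> by (intro sum.atLeastLessThan_concat) auto
      then show "(\<Sum>i\<in>{m..<n}. (cmod (a i))\<^sup>2) \<le> t m"
        unfolding t_def using sum_le_suminf[OF a, of "{..<n}"] by simp
    qed
    finally show "(\<integral>\<^sup>+\<zeta>. ennreal ((cmod (s n \<zeta> - s m \<zeta>))\<^sup>2) \<partial>circle_measure) \<le> ennreal (t m)" .
  qed measurable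
  then obtain f where f [measurable]: "f \<in> borel_measurable circle_measure"
    and fs: "\<And>m. (\<integral>\<^sup>+\<zeta>. ennreal ((cmod (f \<zeta> - s m \<zeta>))\<^sup>2) \<partial>circle_measure) \<le> ennreal (t m)"
    by blast
  have "integrable circle_measure (\<lambda>\<zeta>. (cmod (f \<zeta>))\<^sup>2)"
    using le_less_trans[OF fs[of 0]] by (intro integrableI_nonneg) (auto simp: s_def)
  then have f_L2: "f \<in> L2_circle" by (simp add: L2_circle_def)
  have "(\<lambda>n. fourier_coeff g n * cnj (a n)) sums (LINT \<zeta>|circle_measure. g \<zeta> * cnj (f \<zeta>))"
    if g: "g \<in> L2_circle" for g
  proof -
    define C where "C = (LINT \<zeta>|circle_measure. (cmod (g \<zeta>))\<^sup>2)"
    have [measurable]: "g \<in> borel_measurable circle_measure"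
      and "integrable circle_measure (\<lambda>\<zeta>. (cmod (g \<zeta>))\<^sup>2)"
      using g by (auto simp: L2_circle_def)
    then have C: "(\<integral>\<^sup>+\<zeta>. ennreal ((cmod (g \<zeta>))\<^sup>2) \<partial>circle_measure) = ennreal C" "0 \<le> C"
      unfolding C_def by (auto intro: nn_integral_eq_integral)
    have bound: "(cmod ((LINT \<zeta>|circle_measure. g \<zeta> * cnj (f \<zeta>)) - (\<Sum>n<N. fourier_coeff g n * cnj (a n))))\<^sup>2
        \<le> C * t N" for N
    proof -
      let ?h = "\<lambda>\<zeta>. g \<zeta> * cnj (f \<zeta> - s N \<zeta>)"
      have "(LINT \<zeta>|circle_measure. g \<zeta> * cnj (s N \<zeta>)) =
          (LINT \<zeta>|circle_measure. (\<Sum>n<N. (g \<zeta> * cnj \<zeta> ^ n) * cnj (a n)))"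
        unfolding s_def by (simp add: sum_distrib_left mult_ac)
      also have "\<dots> = (\<Sum>n<N. fourier_coeff g n * cnj (a n))"
        unfolding fourier_coeff_def
        by (subst Bochner_Integration.integral_sum)
           (auto intro!: integrable_mult_continuous_circle L2_circle_integrable[OF g] continuous_intros)
      finally have sN: "(\<Sum>n<N. fourier_coeff g n * cnj (a n)) = (LINT \<zeta>|circle_measure. g \<zeta> * cnj (s N \<zeta>))" ..
      have int: "integrable circle_measure ?h"
        by (intro L2_circle_mult_integrable L2_circle_cnj L2_circle_diff g f_L2 s_L2)
      have "(LINT \<zeta>|circle_measure. g \<zeta> * cnj (f \<zeta>)) - (\<Sum>n<N. fourier_coeff g n * cnj (a n)) =
        (LINT \<zeta>|circle_measure. ?h \<zeta>)"
        unfolding sN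
        by (subst Bochner_Integration.integral_diff [symmetric])
           (auto intro!: L2_circle_mult_integrable L2_circle_cnj g f_L2 s_L2 simp: algebra_simps)
      also have "ennreal (cmod \<dots>) \<le> (\<integral>\<^sup>+\<zeta>. ennreal (cmod (?h \<zeta>)) \<partial>circle_measure)"
        by (rule integral_norm_bound_ennreal[OF int])
      also have "\<dots> = (\<integral>\<^sup>+\<zeta>. ennreal (cmod (g \<zeta>)) * ennreal (cmod (f \<zeta> - s N \<zeta>)) \<partial>circle_measure)"
        by (simp add: norm_mult ennreal_mult flip: complex_cnj_diff)
      finally have "(ennreal (cmod ((LINT \<zeta>|circle_measure. g \<zeta> * cnj (f \<zeta>)) - (\<Sum>n<N. fourier_coeff g n * cnj (a n)))))\<^sup>2
          \<le> (\<integral>\<^sup>+\<zeta>. ennreal (cmod (g \<zeta>)) * ennreal (cmod (f \<zeta> - s N \<zeta>)) \<partial>circle_measure)\<^sup>2"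
        by (rule power_mono) simp
      also have "\<dots> \<le> (\<integral>\<^sup>+\<zeta>. (ennreal (cmod (g \<zeta>)))\<^sup>2 \<partial>circle_measure) * (\<integral>\<^sup>+\<zeta>. (ennreal (cmod (f \<zeta> - s N \<zeta>)))\<^sup>2 \<partial>circle_measure)"
        by (rule Cauchy_Schwarz_nn_integral) measurable
      also have "\<dots> \<le> ennreal C * ennreal (t N)"
        using fs[of N] C by (intro mult_mono) (auto simp: ennreal_power)
      also have "\<dots> = ennreal (C * t N)"
        using C t0[of N] by (simp add: ennreal_mult)
      finally show ?thesis
        using C t0[of N] by (simp add: ennreal_power)
    qed
    have "(\<lambda>N. C * t N) \<longlonglongrightarrow> C * ((\<Sum>n. (cmod (a n))\<^sup>2) - (\<Sum>n. (cmod (a n))\<^sup>2))"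
      unfolding t_def by (intro tendsto_intros summable_LIMSEQ a)
    then have Ct: "(\<lambda>N. C * t N) \<longlonglongrightarrow> 0" by simp
    have "(\<lambda>N. (cmod ((LINT \<zeta>|circle_measure. g \<zeta> * cnj (f \<zeta>)) - (\<Sum>n<N. fourier_coeff g n * cnj (a n))))\<^sup>2) \<longlonglongrightarrow> 0"
      by (rule tendsto_sandwich[OF _ _ tendsto_const Ct]) (intro always_eventually allI bound zero_le_power2)+
    from tendsto_real_sqrt[OF this]
    have "(\<lambda>N. cmod ((LINT \<zeta>|circle_measure. g \<zeta> * cnj (f \<zeta>)) - (\<Sum>n<N. fourier_coeff g n * cnj (a n)))) \<longlonglongrightarrow> 0"
      by simp
    then have "(\<lambda>N. (LINT \<zeta>|circle_measure. g \<zeta> * cnj (f \<zeta>)) - (\<Sum>n<N. fourier_coeff g n * cnj (a n))) \<longlonglongrightarrow> 0"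
      by (rule tendsto_norm_zero_cancel)
    from tendsto_diff[OF tendsto_const[of "LINT \<zeta>|circle_measure. g \<zeta> * cnj (f \<zeta>)"] this]
    show ?thesis
      unfolding sums_def by simp
  qed
  then show ?thesis using f_L2 by blast
qed

text \<open>If \<open>f\<close> denotes the boundary function of \<open>F\<close>, the function sought is \<open>u = f + cnj f - c\<close>: the constant
  is subtracted because index 0 would otherwise be counted twice. For the same reason the pairing
  of \<open>u\<close> with a real \<open>g\<close> is twice the real part of a Hardy inner product, up to a correction by mean
  values.\<close>

lemma boundary_real_function:
  assumes F: "F \<in> hardy_space" and F0: "F 0 = complex_of_real c"
  shows "\<exists>u :: complex \<Rightarrow> real. (\<lambda>\<zeta>. complex_of_real (u \<zeta>)) \<in> L2_circle \<and>
    (\<forall>z\<in>\<D>. szego (\<lambda>\<zeta>. complex_of_real (u \<zeta>)) z = F z) \<and> (LINT \<zeta>|circle_measure. u \<zeta>) = c \<and>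
    (\<forall>g :: complex \<Rightarrow> real. (\<lambda>\<zeta>. complex_of_real (g \<zeta>)) \<in> L2_circle \<longrightarrow>
      szego (\<lambda>\<zeta>. complex_of_real (g \<zeta>)) \<in> hardy_space \<longrightarrow>
      2 * Re (hardy_inner (szego (\<lambda>\<zeta>. complex_of_real (g \<zeta>))) F) =
      (LINT \<zeta>|circle_measure. g \<zeta> * u \<zeta>) + c * (LINT \<zeta>|circle_measure. g \<zeta>))"
proof -
  define a where "a n = (deriv ^^ n) F 0 / fact n" for n
  have a: "(\<lambda>n. a n * z ^ n) sums F z" if "z \<in> \<D>" for z
    using holomorphic_power_series[of F 0 1 z] F that by (simp add: a_def hardy_space_def)
  \<comment> \<open>as \<open>F 0\<close> is real, \<open>cnj (a 0) = c\<close>, and subtracting \<open>c\<close> leaves \<open>a 0\<close> at index 0\<close>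
  have a0: "a 0 = complex_of_real c" using F0 by (simp add: a_def)
  obtain f where f: "f \<in> L2_circle" and pair: "\<And>g. g \<in> L2_circle \<Longrightarrow>
    (\<lambda>n. fourier_coeff g n * cnj (a n)) sums (LINT \<zeta>|circle_measure. g \<zeta> * cnj (f \<zeta>))"
    using riesz_fischer[OF hardy_space_imp_square_summable[OF a F]] by blast
  define u where "u \<zeta> = 2 * Re (f \<zeta>) - c" for \<zeta>
  have u_eq: "complex_of_real (u \<zeta>) = f \<zeta> + cnj (f \<zeta>) - complex_of_real c" for \<zeta>
    by (simp add: u_def complex_eq_iff)
  have u: "(\<lambda>\<zeta>. complex_of_real (u \<zeta>)) \<in> L2_circle"
    unfolding u_eq by (intro L2_circle_diff L2_circle_add L2_circle_cnj f L2_circle_continuous continuous_intros)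
  have int_cnj_f: "integrable circle_measure (\<lambda>\<zeta>. g \<zeta> * cnj (f \<zeta>))" if "g \<in> L2_circle" for g
    by (intro L2_circle_mult_integrable L2_circle_cnj f that)
  have fourier_f: "fourier_coeff f n = a n" for n
  proof -
    have "(\<lambda>m. fourier_coeff (\<lambda>\<zeta>. \<zeta> ^ n) m * cnj (a m)) = (\<lambda>m. if m = n then cnj (a m) else 0)"
      by (auto simp: fourier_coeff_monomial)
    then have "(\<lambda>m. fourier_coeff (\<lambda>\<zeta>. \<zeta> ^ n) m * cnj (a m)) sums cnj (a n)"
      using sums_single[of n "\<lambda>m. cnj (a m)"] by simp
    then have "cnj (a n) = (LINT \<zeta>|circle_measure. \<zeta> ^ n * cnj (f \<zeta>))"
      by (rule sums_unique2) (intro pair L2_circle_continuous continuous_intros)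
    also have "\<dots> = (LINT \<zeta>|circle_measure. cnj (f \<zeta> * cnj \<zeta> ^ n))"
      by (simp add: mult.commute)
    also have "\<dots> = cnj (fourier_coeff f n)"
      unfolding fourier_coeff_def by (rule Bochner_Integration.integral_cnj)
    finally show ?thesis by simp
  qed
  have fourier_cnj_pow: "fourier_coeff (\<lambda>\<zeta>. cnj \<zeta> ^ n) m = (if n + m = 0 then 1 else 0)" for n m
    using circle_orthonormal[of 0 "n + m"] by (auto simp: fourier_coeff_def power_add)
  have fourier_cnj_f: "fourier_coeff (\<lambda>\<zeta>. cnj (f \<zeta>)) n = (if n = 0 then complex_of_real c else 0)" for n
  proof -
    have "(\<lambda>m. fourier_coeff (\<lambda>\<zeta>. cnj \<zeta> ^ n) m * cnj (a m)) =
        (\<lambda>m. if m = 0 then (if n = 0 then complex_of_real c else 0) else 0)"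
      by (auto simp: fourier_cnj_pow a0)
    then have "(\<lambda>m. fourier_coeff (\<lambda>\<zeta>. cnj \<zeta> ^ n) m * cnj (a m)) sums
        (if n = 0 then complex_of_real c else 0)"
      using sums_single[of 0 "\<lambda>m. (if n = 0 then complex_of_real c else 0)"] by simp
    then have "(if n = 0 then complex_of_real c else 0) = (LINT \<zeta>|circle_measure. cnj \<zeta> ^ n * cnj (f \<zeta>))"
      by (rule sums_unique2) (intro pair L2_circle_continuous continuous_intros)
    then show ?thesis by (simp add: fourier_coeff_def mult.commute)
  qed
  have fourier_u: "fourier_coeff (\<lambda>\<zeta>. complex_of_real (u \<zeta>)) n = a n" for n
  proof -
    have "fourier_coeff (\<lambda>\<zeta>. complex_of_real (u \<zeta>)) n =
      fourier_coeff f n + fourier_coeff (\<lambda>\<zeta>. cnj (f \<zeta>)) n - complex_of_real c * fourier_coeff (\<lambda>\<zeta>. \<zeta> ^ 0) n"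
    proof -
      have i: "integrable circle_measure (\<lambda>\<zeta>. f \<zeta> * cnj \<zeta> ^ n)"
        "integrable circle_measure (\<lambda>\<zeta>. cnj (f \<zeta>) * cnj \<zeta> ^ n)"
        "integrable circle_measure (\<lambda>\<zeta>. complex_of_real c * cnj \<zeta> ^ n)"
        by (intro integrable_mult_continuous_circle L2_circle_integrable L2_circle_cnj f continuous_intros
          L2_circle_continuous)+
      show ?thesis
        unfolding fourier_coeff_def u_eq left_diff_distrib distrib_right
        using i by simp
    qed
    then show ?thesis
      by (simp add: fourier_f fourier_cnj_f fourier_coeff_monomial[of 0, simplified] )
  qed
  have "szego (\<lambda>\<zeta>. complex_of_real (u \<zeta>)) z = F z" if "z \<in> \<D>" for z
    using szego_sums[OF L2_circle_integrable[OF u] that] a[OF that] by (simp add: fourier_u sums_iff)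
  moreover have "(LINT \<zeta>|circle_measure. u \<zeta>) = c"
    using fourier_u[of 0] by (simp add: fourier_coeff_def a0)
  moreover have "2 * Re (hardy_inner (szego (\<lambda>\<zeta>. complex_of_real (g \<zeta>))) F) =
      (LINT \<zeta>|circle_measure. g \<zeta> * u \<zeta>) + c * (LINT \<zeta>|circle_measure. g \<zeta>)"
    if g: "(\<lambda>\<zeta>. complex_of_real (g \<zeta>)) \<in> L2_circle"
      and hardy: "szego (\<lambda>\<zeta>. complex_of_real (g \<zeta>)) \<in> hardy_space" for g :: "complex \<Rightarrow> real"
  proof -
    let ?I = "LINT \<zeta>|circle_measure. complex_of_real (g \<zeta>) * cnj (f \<zeta>)"
    have "hardy_inner (szego (\<lambda>\<zeta>. complex_of_real (g \<zeta>))) F = ?I"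
      using sums_unique2[OF hardy_inner_eq_suminf[OF szego_sums[OF L2_circle_integrable[OF g]] hardy a F] pair[OF g]] .
    moreover have "Re ?I = (LINT \<zeta>|circle_measure. g \<zeta> * Re (f \<zeta>))"
      by (subst integral_Re[OF int_cnj_f[OF g], symmetric]) simp
    moreover have "integrable circle_measure (\<lambda>\<zeta>. Re (complex_of_real (g \<zeta>) * cnj (f \<zeta>)))"
      using int_cnj_f[OF g] by (rule integrable_Re)
    then have "(LINT \<zeta>|circle_measure. 2 * (g \<zeta> * Re (f \<zeta>)) - c * g \<zeta>) =
        2 * (LINT \<zeta>|circle_measure. g \<zeta> * Re (f \<zeta>)) - c * (LINT \<zeta>|circle_measure. g \<zeta>)"
      using integrable_Re[OF L2_circle_integrable[OF g]] by simp
    moreover have "g \<zeta> * u \<zeta> = 2 * (g \<zeta> * Re (f \<zeta>)) - c * g \<zeta>" for \<zeta>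
      by (simp add: u_def algebra_simps)
    ultimately show ?thesis by simp
  qed
  ultimately show ?thesis using u by (intro exI[of _ u]) blast
qed

section \<open>Dirichlet energies\<close>

lemma space_disk [simp]: "space disk_measure = \<D>"
  by (simp add: disk_measure_def space_scale_measure)

lemma holomorphic_measurable_disk: "F holomorphic_on \<D> \<Longrightarrow> F \<in> borel_measurable disk_measure"
  unfolding disk_measure_def
  using continuous_imp_measurable_on_sets_lebesgue[OF holomorphic_on_imp_continuous_on]
  by (simp add: measurable_def space_scale_measure)

lemma dirichlet_space_energy_integrable:
  assumes \<omega>: "weight \<omega>" and F: "F \<in> dirichlet_space \<omega>"
  shows "integrable disk_measure (\<lambda>z. (cmod (deriv F z))\<^sup>2 * \<omega> z)"
proof (rule integrableI_nonneg)
  have [measurable]: "deriv F \<in> borel_measurable disk_measure" "\<omega> \<in> borel_measurable disk_measure"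
    using F \<omega> by (auto simp: dirichlet_space_def weight_def intro: holomorphic_measurable_disk holomorphic_deriv)
  show "(\<lambda>z. (cmod (deriv F z))\<^sup>2 * \<omega> z) \<in> borel_measurable disk_measure" by measurable
qed (use F \<omega> in \<open>auto simp: dirichlet_space_def weight_def\<close>)

lemma dirichlet_form_integrable:
  assumes \<omega>: "weight \<omega>" and F: "F \<in> dirichlet_space \<omega>" and G: "G \<in> dirichlet_space \<omega>"
  shows "integrable disk_measure (\<lambda>z. deriv F z * cnj (deriv G z) * complex_of_real (\<omega> z))"
proof (rule Bochner_Integration.integrable_bound)
  show "integrable disk_measure (\<lambda>z. (cmod (deriv F z))\<^sup>2 * \<omega> z + (cmod (deriv G z))\<^sup>2 * \<omega> z)"
    by (intro Bochner_Integration.integrable_add dirichlet_space_energy_integrable assms)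
  have [measurable]: "deriv F \<in> borel_measurable disk_measure" "deriv G \<in> borel_measurable disk_measure"
    "\<omega> \<in> borel_measurable disk_measure"
    using F G \<omega> by (auto simp: dirichlet_space_def weight_def intro: holomorphic_measurable_disk holomorphic_deriv)
  have [measurable]: "(\<lambda>z. cnj (deriv G z)) \<in> borel_measurable disk_measure"
    by (intro measurable_compose[OF _ borel_measurable_continuous_onI, of _ _ cnj] continuous_intros) measurable
  show "(\<lambda>z. deriv F z * cnj (deriv G z) * complex_of_real (\<omega> z)) \<in> borel_measurable disk_measure"
    by measurable
  show "AE z in disk_measure. norm (deriv F z * cnj (deriv G z) * complex_of_real (\<omega> z))
      \<le> norm ((cmod (deriv F z))\<^sup>2 * \<omega> z + (cmod (deriv G z))\<^sup>2 * \<omega> z)"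
  proof (rule AE_I2)
    fix z assume "z \<in> space disk_measure"
    then have nn: "0 \<le> \<omega> z" using \<omega> by (simp add: weight_def)
    have "cmod (deriv F z) * cmod (deriv G z) \<le> (cmod (deriv F z))\<^sup>2 + (cmod (deriv G z))\<^sup>2"
      by (rule cmod_mult_le_sum_squares)
    then have "cmod (deriv F z) * cmod (deriv G z) * \<omega> z \<le> ((cmod (deriv F z))\<^sup>2 + (cmod (deriv G z))\<^sup>2) * \<omega> z"
      by (rule mult_right_mono[OF _ nn])
    then show "norm (deriv F z * cnj (deriv G z) * complex_of_real (\<omega> z))
      \<le> norm ((cmod (deriv F z))\<^sup>2 * \<omega> z + (cmod (deriv G z))\<^sup>2 * \<omega> z)"
      using nn by (simp add: norm_mult distrib_right)
  qed
qed

text \<open>Pointwise \<open>Re (F' * cnj G') \<le> (\<bar>F'\<bar>\<^sup>2 + \<bar>G'\<bar>\<^sup>2) / 2\<close>; integrated against \<open>\<omega>\<close>, the right-hand side is at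
  most the energy of \<open>G\<close>.\<close>

lemma dirichlet_form_le_diagonal:
  assumes \<omega>: "weight \<omega>" and F: "F \<in> dirichlet_space \<omega>" and G: "G \<in> dirichlet_space \<omega>"
    and le: "(\<integral>\<^sup>+ z. ennreal ((cmod (deriv F z))\<^sup>2 * \<omega> z) \<partial>disk_measure) \<le>
      (\<integral>\<^sup>+ z. ennreal ((cmod (deriv G z))\<^sup>2 * \<omega> z) \<partial>disk_measure)"
  shows "Re (LINT z|disk_measure. deriv F z * cnj (deriv G z) * complex_of_real (\<omega> z)) \<le>
    Re (LINT z|disk_measure. deriv G z * cnj (deriv G z) * complex_of_real (\<omega> z))"
proof -
  let ?E = "\<lambda>H z. (cmod (deriv H z))\<^sup>2 * \<omega> z"
  have \<omega>0: "0 \<le> \<omega> z" if "z \<in> \<D>" for z using \<omega> that by (simp add: weight_def)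
  note int = dirichlet_space_energy_integrable[OF \<omega> F] dirichlet_space_energy_integrable[OF \<omega> G]
  have "ennreal (LINT z|disk_measure. ?E F z) \<le> ennreal (LINT z|disk_measure. ?E G z)"
    using le int \<omega>0 by (subst (asm) (1 2) nn_integral_eq_integral) (auto intro!: AE_I2)
  moreover have "0 \<le> (LINT z|disk_measure. ?E G z)"
    using \<omega>0 by (intro Bochner_Integration.integral_nonneg) auto
  ultimately have E: "(LINT z|disk_measure. ?E F z) \<le> (LINT z|disk_measure. ?E G z)" by simp
  note intFG = dirichlet_form_integrable[OF \<omega> F G]
  have "Re (LINT z|disk_measure. deriv F z * cnj (deriv G z) * complex_of_real (\<omega> z)) =
      (LINT z|disk_measure. Re (deriv F z * cnj (deriv G z) * complex_of_real (\<omega> z)))"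
    by (rule integral_Re[OF intFG, symmetric])
  also have "\<dots> \<le> (LINT z|disk_measure. (?E F z + ?E G z) / 2)"
  proof (rule integral_mono)
    show "integrable disk_measure (\<lambda>z. Re (deriv F z * cnj (deriv G z) * complex_of_real (\<omega> z)))"
      by (rule integrable_Re[OF intFG])
    show "integrable disk_measure (\<lambda>z. (?E F z + ?E G z) / 2)"
      using int by simp
    fix z assume z: "z \<in> space disk_measure"
    have "Re (deriv F z * cnj (deriv G z)) \<le> cmod (deriv F z) * cmod (deriv G z)"
      by (metis complex_Re_le_cmod complex_mod_cnj norm_mult)
    also have "\<dots> \<le> ((cmod (deriv F z))\<^sup>2 + (cmod (deriv G z))\<^sup>2) / 2"
      using sum_squares_bound[of "cmod (deriv F z)" "cmod (deriv G z)"] by simp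
    finally have "Re (deriv F z * cnj (deriv G z)) * \<omega> z \<le> (((cmod (deriv F z))\<^sup>2 + (cmod (deriv G z))\<^sup>2) / 2) * \<omega> z"
      using z \<omega>0 by (intro mult_right_mono) auto
    moreover have "Re (deriv F z * cnj (deriv G z) * complex_of_real (\<omega> z)) = Re (deriv F z * cnj (deriv G z)) * \<omega> z"
      by (simp only: Re_complex_of_real_mult mult.commute[of _ "complex_of_real (\<omega> z)"] mult.commute[of "\<omega> z"])
    ultimately show "Re (deriv F z * cnj (deriv G z) * complex_of_real (\<omega> z)) \<le> (?E F z + ?E G z) / 2"
      by (simp only: distrib_right times_divide_eq_left)
  qed
  also have "\<dots> = ((LINT z|disk_measure. ?E F z) + (LINT z|disk_measure. ?E G z)) / 2"
    using int by simp
  also have "\<dots> \<le> (LINT z|disk_measure. ?E G z)" using E by simp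
  also have "\<dots> = Re (complex_of_real (LINT z|disk_measure. ?E G z))" by simp
  also have "\<dots> = Re (LINT z|disk_measure. deriv G z * cnj (deriv G z) * complex_of_real (\<omega> z))"
    by (simp only: of_real_mult complex_norm_square flip: integral_complex_of_real)
  finally show ?thesis .
qed

lemma poisson_energy_eq:
  fixes u :: "complex \<Rightarrow> real"
  assumes \<omega>: "weight \<omega>" and u: "integrable circle_measure u"
  shows "(\<integral>\<^sup>+ z. ennreal (grad_norm_sq (poisson_extension (\<lambda>\<zeta>. complex_of_real (u \<zeta>))) z * \<omega> z) \<partial>disk_measure) =
    2 * (\<integral>\<^sup>+ z. ennreal ((cmod (deriv (szego (\<lambda>\<zeta>. complex_of_real (u \<zeta>))) z))\<^sup>2 * \<omega> z) \<partial>disk_measure)"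
proof -
  let ?S = "szego (\<lambda>\<zeta>. complex_of_real (u \<zeta>))"
  have S: "?S holomorphic_on \<D>" using u by (intro holomorphic_szego) simp
  have [measurable]: "deriv ?S \<in> borel_measurable disk_measure" "\<omega> \<in> borel_measurable disk_measure"
    using S \<omega> by (auto simp: weight_def intro: holomorphic_measurable_disk holomorphic_deriv)
  have "(\<integral>\<^sup>+ z. ennreal (grad_norm_sq (poisson_extension (\<lambda>\<zeta>. complex_of_real (u \<zeta>))) z * \<omega> z) \<partial>disk_measure) =
    (\<integral>\<^sup>+ z. 2 * ennreal ((cmod (deriv ?S z))\<^sup>2 * \<omega> z) \<partial>disk_measure)"
  proof (rule nn_integral_cong)
    fix z assume "z \<in> space disk_measure"
    then have z: "z \<in> \<D>" by simp
    then have "0 \<le> \<omega> z" using \<omega> by (simp add: weight_def)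
    moreover have "grad_norm_sq (poisson_extension (\<lambda>\<zeta>. complex_of_real (u \<zeta>))) z = 2 * (cmod (deriv ?S z))\<^sup>2"
      by (rule grad_norm_sq_Re[OF S z poisson_extension_eq_szego[OF u]])
    ultimately show "ennreal (grad_norm_sq (poisson_extension (\<lambda>\<zeta>. complex_of_real (u \<zeta>))) z * \<omega> z) =
        2 * ennreal ((cmod (deriv ?S z))\<^sup>2 * \<omega> z)"
      by (simp add: ennreal_mult'' mult.assoc flip: ennreal_numeral)
  qed
  also have "\<dots> = 2 * (\<integral>\<^sup>+ z. ennreal ((cmod (deriv ?S z))\<^sup>2 * \<omega> z) \<partial>disk_measure)"
    by (rule nn_integral_cmult) measurable
  finally show ?thesis .
qed

text \<open>Here, and only here, the Douglas formula is used: since \<open>\<bar>\<bar>a\<bar> - \<bar>b\<bar>\<bar> \<le> \<bar>a - b\<bar>\<close>, replacing boundary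
  values by their absolute values does not increase the integrand on the right of the formula,
  whatever the measure \<open>J\<close> is.\<close>

lemma douglas_weight_abs_contraction:
  fixes u :: "complex \<Rightarrow> real"
  assumes \<omega>: "douglas_weight \<omega>" and u: "(\<lambda>\<zeta>. complex_of_real (u \<zeta>)) \<in> L2_circle"
  shows "(\<integral>\<^sup>+ z. ennreal (grad_norm_sq (poisson_extension (\<lambda>\<zeta>. complex_of_real \<bar>u \<zeta>\<bar>)) z * \<omega> z) \<partial>disk_measure)
    \<le> (\<integral>\<^sup>+ z. ennreal (grad_norm_sq (poisson_extension (\<lambda>\<zeta>. complex_of_real (u \<zeta>))) z * \<omega> z) \<partial>disk_measure)"
proof -
  obtain J :: "(complex \<times> complex) measure" where J: "\<And>f. f \<in> L2_circle \<Longrightarrow>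
        (\<integral>\<^sup>+ z. ennreal (grad_norm_sq (poisson_extension f) z * \<omega> z) \<partial>disk_measure) =
        (\<integral>\<^sup>+ (\<zeta>, \<xi>). ennreal ((cmod (f \<zeta> - f \<xi>))\<^sup>2) \<partial>J)"
    using \<omega> unfolding douglas_weight_def by blast
  have "(\<integral>\<^sup>+ (\<zeta>, \<xi>). ennreal ((cmod (complex_of_real \<bar>u \<zeta>\<bar> - complex_of_real \<bar>u \<xi>\<bar>))\<^sup>2) \<partial>J) \<le>
      (\<integral>\<^sup>+ (\<zeta>, \<xi>). ennreal ((cmod (complex_of_real (u \<zeta>) - complex_of_real (u \<xi>)))\<^sup>2) \<partial>J)"
    by (intro nn_integral_mono)
       (auto intro!: ennreal_leI abs_le_square_iff[THEN iffD1] simp flip: of_real_diff)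
  then show ?thesis
    unfolding J[OF u] J[OF L2_circle_abs[OF u]] .
qed

lemma poisson_extension_mono:
  fixes u v :: "complex \<Rightarrow> real"
  assumes u: "integrable circle_measure u" and v: "integrable circle_measure v" and z: "z \<in> \<D>"
    and le: "AE \<zeta> in circle_measure. u \<zeta> \<le> v \<zeta>"
  shows "Re (poisson_extension (\<lambda>\<zeta>. complex_of_real (u \<zeta>)) z) \<le> Re (poisson_extension (\<lambda>\<zeta>. complex_of_real (v \<zeta>)) z)"
proof -
  let ?P = "\<lambda>\<zeta>. (1 - (cmod z)\<^sup>2) / (cmod (\<zeta> - z))\<^sup>2"
  have cont: "continuous_on \<T> (\<lambda>\<zeta>. complex_of_real (?P \<zeta>))"
    using z by (intro continuous_intros) auto
  have int: "integrable circle_measure (\<lambda>\<zeta>. ?P \<zeta> * w \<zeta>)" if "integrable circle_measure w" for w :: "complex \<Rightarrow> real"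
  proof -
    have "integrable circle_measure (\<lambda>\<zeta>. complex_of_real (w \<zeta>) * complex_of_real (?P \<zeta>))"
      by (rule integrable_mult_continuous_circle[OF _ cont]) (use that in simp)
    from integrable_Re[OF this] show ?thesis
      by (simp add: mult.commute)
  qed
  have eq: "Re (poisson_extension (\<lambda>\<zeta>. complex_of_real (w \<zeta>)) z) = (LINT \<zeta>|circle_measure. ?P \<zeta> * w \<zeta>)"
    for w :: "complex \<Rightarrow> real"
    unfolding poisson_extension_def scaleR_conv_of_real of_real_mult [symmetric] integral_complex_of_real
    by simp
  have "0 \<le> ?P \<zeta>" for \<zeta>
    using z by (simp add: power_le_one)
  then show ?thesis
    unfolding eq using le
    by (intro integral_mono_AE int u v) (auto elim!: eventually_mono intro!: mult_left_mono simp del: times_divide_eq_left)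
qed

section \<open>Positivity of the kernel\<close>

text \<open>Constants have zero Dirichlet energy, so reproducing the constant 1 at \<open>w\<close> involves only the
  Hardy inner product of 1 and \<open>k(\<cdot>, w)\<close>, which is the conjugate of \<open>k 0 w\<close>.\<close>

lemma reproducing_kernel_at_0:
  assumes sub: "dirichlet_space \<omega> \<subseteq> hardy_space" and k: "reproducing_kernel \<omega> k" and w: "w \<in> \<D>"
  shows "k 0 w = 1"
proof -
  let ?K = "\<lambda>z. k z w"
  have K: "?K \<in> hardy_space" using k w sub by (auto simp: reproducing_kernel_def)
  have one: "(\<lambda>z. 1) \<in> dirichlet_space \<omega>" by (simp add: dirichlet_space_def)
  let ?a = "\<lambda>n. (deriv ^^ n) ?K 0 / fact n"
  have a: "(\<lambda>n. ?a n * z ^ n) sums ?K z" if "z \<in> \<D>" for z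
    using holomorphic_power_series[of ?K 0 1 z] K that by (simp add: hardy_space_def)
  have b: "(\<lambda>n. (if n = 0 then 1 else 0) * z ^ n) sums 1" for z :: complex
    using sums_single[of 0 "\<lambda>n. z ^ n"] by (simp add: if_distrib[where f = "\<lambda>x. x * _"] cong: if_cong)
  have "(\<lambda>n. (if n = 0 then 1 else 0) * cnj (?a n)) sums hardy_inner (\<lambda>z. 1) ?K"
    using one sub by (intro hardy_inner_eq_suminf[OF b _ a K]) auto
  moreover have "(\<lambda>n. (if n = 0 then 1 else 0) * cnj (?a n)) = (\<lambda>n. if n = 0 then cnj (?a n) else 0)"
    by auto
  ultimately have "hardy_inner (\<lambda>z. 1) ?K = cnj (k 0 w)"
    using sums_single[of 0 "\<lambda>n. cnj (?a n)"] by (simp add: sums_iff)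
  moreover have "f w = dirichlet_inner \<omega> f ?K" if "f \<in> dirichlet_space \<omega>" for f
    using k w that by (simp add: reproducing_kernel_def)
  from this[OF one] have "1 = dirichlet_inner \<omega> (\<lambda>z. 1) ?K" .
  ultimately have "cnj (k 0 w) = 1" by (simp add: dirichlet_inner_def)
  then show ?thesis by (metis complex_cnj_cnj complex_cnj_one)
qed

theorem theorem3p2:
  fixes \<omega> :: "complex \<Rightarrow> real" and k :: "complex \<Rightarrow> complex \<Rightarrow> complex"
  assumes "douglas_weight \<omega>"
    and "dirichlet_space \<omega> \<subseteq> hardy_space"
    and "reproducing_kernel \<omega> k"
  shows "\<forall>z\<in>\<D>. \<forall>w\<in>\<D>. 2 * Re (k z w) - 1 \<ge> 0"
proof (intro ballI)
  fix z w assume z: "z \<in> \<D>" and w: "w \<in> \<D>"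
  define K where "K = (\<lambda>z. k z w)"
  have \<omega>: "weight \<omega>" using assms(1) by (simp add: douglas_weight_def)
  have K: "K \<in> dirichlet_space \<omega>"
    and repr: "\<And>f. f \<in> dirichlet_space \<omega> \<Longrightarrow> f w = dirichlet_inner \<omega> f K"
    using assms(3) w by (auto simp: reproducing_kernel_def K_def)
  have K_hardy: "K \<in> hardy_space" using K assms(2) by blast
  have "K 0 = complex_of_real 1"
    using reproducing_kernel_at_0[OF assms(2,3) w] by (simp add: K_def)
  from boundary_real_function[OF K_hardy this]
  obtain u :: "complex \<Rightarrow> real" where u: "(\<lambda>\<zeta>. complex_of_real (u \<zeta>)) \<in> L2_circle"
    and szego_u: "\<And>z. z \<in> \<D> \<Longrightarrow> szego (\<lambda>\<zeta>. complex_of_real (u \<zeta>)) z = K z"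
    and mean_u: "(LINT \<zeta>|circle_measure. u \<zeta>) = 1"
    and pair: "\<And>g :: complex \<Rightarrow> real. (\<lambda>\<zeta>. complex_of_real (g \<zeta>)) \<in> L2_circle \<Longrightarrow>
      szego (\<lambda>\<zeta>. complex_of_real (g \<zeta>)) \<in> hardy_space \<Longrightarrow>
      2 * Re (hardy_inner (szego (\<lambda>\<zeta>. complex_of_real (g \<zeta>))) K) =
      (LINT \<zeta>|circle_measure. g \<zeta> * u \<zeta>) + 1 * (LINT \<zeta>|circle_measure. g \<zeta>)"
    by blast
  \<comment> \<open>\<open>u\<close> has Poisson extension \<open>2 * Re K - 1\<close>; the aim is to show \<open>u = \<bar>u\<bar>\<close> almost everywhere\<close>
  let ?U = "szego (\<lambda>\<zeta>. complex_of_real (u \<zeta>))" and ?V = "szego (\<lambda>\<zeta>. complex_of_real \<bar>u \<zeta>\<bar>)"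
  note abs_u = L2_circle_abs[OF u]
  have int_u: "integrable circle_measure u" and int_abs_u: "integrable circle_measure (\<lambda>\<zeta>. \<bar>u \<zeta>\<bar>)"
    using integrable_Re[OF L2_circle_integrable[OF u]] by auto
  note hol = holomorphic_szego[OF L2_circle_integrable[OF u]] holomorphic_szego[OF L2_circle_integrable[OF abs_u]]
  have deriv_U: "deriv ?U z = deriv K z" if "z \<in> \<D>" for z
    by (rule complex_derivative_transform_within_open[OF hol(1) _ open_ball that szego_u])
       (use K in \<open>auto simp: dirichlet_space_def\<close>)
  have energy_U: "(\<integral>\<^sup>+ z. ennreal ((cmod (deriv ?U z))\<^sup>2 * \<omega> z) \<partial>disk_measure) =
      (\<integral>\<^sup>+ z. ennreal ((cmod (deriv K z))\<^sup>2 * \<omega> z) \<partial>disk_measure)"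
    by (intro nn_integral_cong) (simp add: deriv_U)
  have U: "?U \<in> dirichlet_space \<omega>"
    using K hol energy_U by (simp add: dirichlet_space_def)
  have "2 * (\<integral>\<^sup>+ z. ennreal ((cmod (deriv ?V z))\<^sup>2 * \<omega> z) \<partial>disk_measure) \<le>
      2 * (\<integral>\<^sup>+ z. ennreal ((cmod (deriv ?U z))\<^sup>2 * \<omega> z) \<partial>disk_measure)"
    using douglas_weight_abs_contraction[OF assms(1) u]
    unfolding poisson_energy_eq[OF \<omega> int_u] poisson_energy_eq[OF \<omega> int_abs_u] .
  then have energy_V: "(\<integral>\<^sup>+ z. ennreal ((cmod (deriv ?V z))\<^sup>2 * \<omega> z) \<partial>disk_measure) \<le>
      (\<integral>\<^sup>+ z. ennreal ((cmod (deriv K z))\<^sup>2 * \<omega> z) \<partial>disk_measure)"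
    unfolding energy_U by (simp add: ennreal_mult_le_mult_iff)
  then have V: "?V \<in> dirichlet_space \<omega>"
    using K hol by (auto simp: dirichlet_space_def intro: le_less_trans)
  let ?D = "\<lambda>f. Re (LINT z|disk_measure. deriv f z * cnj (deriv K z) * complex_of_real (\<omega> z))"
  have form: "?D ?V \<le> ?D K"
    by (rule dirichlet_form_le_diagonal[OF \<omega> V K energy_V])
  have "?D ?U = ?D K"
    by (intro arg_cong[of _ _ Re] Bochner_Integration.integral_cong refl) (simp add: deriv_U)
  note form = form[folded this]
  \<comment> \<open>the reproducing property of \<open>u\<close> in the real harmonic space, evaluated at \<open>w\<close>\<close>
  have P: "Re (poisson_extension (\<lambda>\<zeta>. complex_of_real (g \<zeta>)) w) = (LINT \<zeta>|circle_measure. g \<zeta> * u \<zeta>) +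
      2 * ?D (szego (\<lambda>\<zeta>. complex_of_real (g \<zeta>)))"
    if g: "(\<lambda>\<zeta>. complex_of_real (g \<zeta>)) \<in> L2_circle" and G: "szego (\<lambda>\<zeta>. complex_of_real (g \<zeta>)) \<in> dirichlet_space \<omega>"
    for g :: "complex \<Rightarrow> real"
  proof -
    have "integrable circle_measure g"
      using integrable_Re[OF L2_circle_integrable[OF g]] by simp
    from poisson_extension_eq_szego[OF this w]
    have "Re (poisson_extension (\<lambda>\<zeta>. complex_of_real (g \<zeta>)) w) =
        2 * Re (szego (\<lambda>\<zeta>. complex_of_real (g \<zeta>)) w) - (LINT \<zeta>|circle_measure. g \<zeta>)"
      by simp
    also have "szego (\<lambda>\<zeta>. complex_of_real (g \<zeta>)) w = dirichlet_inner \<omega> (szego (\<lambda>\<zeta>. complex_of_real (g \<zeta>))) K"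
      by (rule repr[OF G])
    finally show ?thesis
      using pair[OF g] G assms(2) by (auto simp: dirichlet_inner_def)
  qed
  have "Re (poisson_extension (\<lambda>\<zeta>. complex_of_real (u \<zeta>)) w) \<le> Re (poisson_extension (\<lambda>\<zeta>. complex_of_real \<bar>u \<zeta>\<bar>) w)"
    by (intro poisson_extension_mono int_u int_abs_u w AE_I2) simp
  \<comment> \<open>evaluation at \<open>w\<close> increases and the energy term does not, which leaves the \<open>L\<^sup>2\<close> term\<close>
  then have le: "(LINT \<zeta>|circle_measure. u \<zeta> * u \<zeta>) \<le> (LINT \<zeta>|circle_measure. \<bar>u \<zeta>\<bar> * u \<zeta>)"
    using form unfolding P[OF u U] P[OF abs_u V] by linarith
  have int_uu: "integrable circle_measure (\<lambda>\<zeta>. u \<zeta> * u \<zeta>)" "integrable circle_measure (\<lambda>\<zeta>. \<bar>u \<zeta>\<bar> * u \<zeta>)"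
    using integrable_Re[OF L2_circle_mult_integrable[OF u u]] integrable_Re[OF L2_circle_mult_integrable[OF abs_u u]]
    by simp_all
  \<comment> \<open>the integrand is \<open>2 * u\<^sup>2\<close> where \<open>u < 0\<close> and vanishes elsewhere\<close>
  have nonneg: "0 \<le> u \<zeta> * u \<zeta> - \<bar>u \<zeta>\<bar> * u \<zeta>" for \<zeta>
    by (simp add: abs_if)
  have "(LINT \<zeta>|circle_measure. u \<zeta> * u \<zeta> - \<bar>u \<zeta>\<bar> * u \<zeta>) = 0"
    using le int_uu Bochner_Integration.integral_nonneg[of circle_measure "\<lambda>\<zeta>. u \<zeta> * u \<zeta> - \<bar>u \<zeta>\<bar> * u \<zeta>"] nonneg
    by simp
  then have "AE \<zeta> in circle_measure. u \<zeta> * u \<zeta> - \<bar>u \<zeta>\<bar> * u \<zeta> = 0"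
    using integral_nonneg_eq_0_iff_AE[of circle_measure "\<lambda>\<zeta>. u \<zeta> * u \<zeta> - \<bar>u \<zeta>\<bar> * u \<zeta>"] int_uu nonneg
    by (simp del: right_minus_eq)
  then have "AE \<zeta> in circle_measure. 0 \<le> u \<zeta>"
    by eventually_elim (auto simp: abs_if split: if_splits)
  then have "Re (poisson_extension (\<lambda>\<zeta>. complex_of_real 0) z) \<le> Re (poisson_extension (\<lambda>\<zeta>. complex_of_real (u \<zeta>)) z)"
    by (intro poisson_extension_mono int_u z) auto
  also have "\<dots> = 2 * Re (k z w) - 1"
    by (simp add: poisson_extension_eq_szego[OF int_u z] szego_u[OF z] mean_u K_def)
  finally show "0 \<le> 2 * Re (k z w) - 1"
    by (simp add: poisson_extension_def)
qed

end
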